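(* Let $G$ be a finite simple graph that is $\delta$-dense. If $G$ and $G^2$ have nested solutions, then $G^d$ has nested solutions for every integer $d\geq 3$.
   Context: All graphs are finite and simple. For a graph $G=(V,E)$ and $A\subseteq V$, let $I_G(A)$ be the set of edges of $G$ with both endpoints in $A$, and for $0\le m\le |V|$ let $I_G(m)=\max_{A\subseteq V,\,|A|=m}|I_G(A)|$ (so $I_G(0)=0$). A set $A$ with $|A|=m$ and $|I_G(A)|=I_G(m)$ is called optimal. $G$ has nested solutions (NS) if there are sets $A_1\subseteq A_2\subseteq\cdots\subseteq A_{|V|}$ with $|A_i|=i$ and each $A_i$ optimal. The $\delta$-sequence of $G$ is $\delta_G=(\delta_G(1),\dots,\delta_G(|V|))$ where $\delta_G(m)=I_G(m)-I_G(m-1)$. Partition $\delta_G$ into consecutive maximal strictly increasing runs ("monotonic segments"); let $r$ be the number of segments, let $M_{G,i}$ be the set of positions in the $i$-th segment, and let $s_{G,i}=\delta_G\bigl(1+\sum_{k=1}^{i-1}|M_{G,k}|\bigr)$ be the first value of the $i$-th segment. $G$ is called $\delta$-dense iff $s_{G,2},\dots,s_{G,r}>1$ (i.e. every segment other than the first starts with a value at least $2$). The Cartesian product $H\square G$ has vertex set $V_H\times V_G$, with $(x,y)$ adjacent to $(u,v)$ iff either $x=u$ and $\{y,v\}\in E_G$, or $\{x,u\}\in E_H$ and $y=v$. $G^d$ denotes the $d$-fold Cartesian power $G\square\cdots\square G$. *)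

theory Defs
  imports Main
begin

record 'a ugraph =
  verts :: "'a set"
  edges :: "'a set set"

definition simple_graph :: "'a ugraph \<Rightarrow> bool" where
  "simple_graph G \<longleftrightarrow>
     finite (verts G) \<and> (\<forall>e\<in>edges G. e \<subseteq> verts G \<and> card e = 2)"

definition induced_edges :: "'a ugraph \<Rightarrow> 'a set \<Rightarrow> 'a set set" where
  "induced_edges G A = {e \<in> edges G. e \<subseteq> A}"

definition max_induced :: "'a ugraph \<Rightarrow> nat \<Rightarrow> nat" where
  "max_induced G m = Max {card (induced_edges G A) | A. A \<subseteq> verts G \<and> card A = m}"

definition optimal :: "'a ugraph \<Rightarrow> nat \<Rightarrow> 'a set \<Rightarrow> bool" where
  "optimal G m A \<longleftrightarrow>
     A \<subseteq> verts G \<and> card A = m \<and> card (induced_edges G A) = max_induced G m"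

definition nested_solutions :: "'a ugraph \<Rightarrow> bool" where
  "nested_solutions G \<longleftrightarrow>
     (\<exists>A. (\<forall>i\<in>{1..card (verts G)}. optimal G i (A i)) \<and>
          (\<forall>i\<in>{1..<card (verts G)}. A i \<subseteq> A (Suc i)))"

definition delta :: "'a ugraph \<Rightarrow> nat \<Rightarrow> int" where
  "delta G m = int (max_induced G m) - int (max_induced G (m - 1))"

text \<open>Greedy splitting of a list of positions into maximal consecutive runs on which \<open>f\<close> is
  strictly increasing; see \<open>concat_increasing_runs\<close>, \<open>increasing_runs_strict\<close>,
  \<open>increasing_runs_maximal\<close>.\<close>

fun increasing_runs :: "('b \<Rightarrow> 'c::linorder) \<Rightarrow> 'b list \<Rightarrow> 'b list list" where
  "increasing_runs f [] = []"
| "increasing_runs f [x] = [[x]]"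
| "increasing_runs f (x # y # ys) =
     (let rs = increasing_runs f (y # ys) in
      if f x < f y then (x # hd rs) # tl rs else [x] # rs)"

lemma increasing_runs_Cons:
  obtains xs rs where "increasing_runs f (x # ys) = (x # xs) # rs"
proof -
  have "\<exists>xs rs. increasing_runs f (x # ys) = (x # xs) # rs"
    by (cases ys) (auto simp: Let_def)
  then show ?thesis using that by blast
qed

lemma concat_increasing_runs: "concat (increasing_runs f xs) = xs"
proof (induction f xs rule: increasing_runs.induct)
  case (3 f x y ys)
  obtain zs rs where "increasing_runs f (y # ys) = (y # zs) # rs"
    by (rule increasing_runs_Cons)
  with 3 show ?case by (auto simp: Let_def)
qed auto

lemma increasing_runs_strict:
  "r \<in> set (increasing_runs f xs) \<Longrightarrow> r \<noteq> [] \<and> sorted_wrt (\<lambda>x y. f x < f y) r"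
proof (induction f xs arbitrary: r rule: increasing_runs.induct)
  case (3 f x y ys)
  obtain zs rs where eq: "increasing_runs f (y # ys) = (y # zs) # rs"
    by (rule increasing_runs_Cons)
  have IH: "\<And>r. r \<in> set ((y # zs) # rs) \<Longrightarrow> r \<noteq> [] \<and> sorted_wrt (\<lambda>x y. f x < f y) r"
    using "3.IH" unfolding eq by blast
  have "sorted_wrt (\<lambda>x y. f x < f y) (y # zs)" using IH[of "y # zs"] by simp
  then have "f x < f y \<Longrightarrow> sorted_wrt (\<lambda>x y. f x < f y) (x # y # zs)"
    by (auto intro: less_trans)
  with "3.prems" IH show ?case by (auto simp: eq Let_def split: if_splits)
qed auto

lemma increasing_runs_maximal:
  "Suc i < length (increasing_runs f xs) \<Longrightarrow>
     f (hd (increasing_runs f xs ! Suc i)) \<le> f (last (increasing_runs f xs ! i))"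
proof (induction f xs arbitrary: i rule: increasing_runs.induct)
  case (3 f x y ys)
  obtain zs rs where eq: "increasing_runs f (y # ys) = (y # zs) # rs"
    by (rule increasing_runs_Cons)
  show ?case
  proof (cases "f x < f y")
    case True
    then show ?thesis using "3.prems" "3.IH"[of i] by (cases i) (auto simp: eq Let_def)
  next
    case False
    then show ?thesis using "3.prems" "3.IH"[of "i - 1"]
      by (cases i) (auto simp: eq Let_def)
  qed
qed auto

definition segments :: "'a ugraph \<Rightarrow> nat list list" where
  "segments G = increasing_runs (delta G) [1..<Suc (card (verts G))]"

definition num_segments :: "'a ugraph \<Rightarrow> nat" where
  "num_segments G = length (segments G)"

text \<open>Segments are numbered from 1.\<close>

definition segment :: "'a ugraph \<Rightarrow> nat \<Rightarrow> nat set" where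
  "segment G i = set (segments G ! (i - 1))"

definition segment_start :: "'a ugraph \<Rightarrow> nat \<Rightarrow> int" where
  "segment_start G i = delta G (1 + (\<Sum>k=1..i - 1. card (segment G k)))"

definition delta_dense :: "'a ugraph \<Rightarrow> bool" where
  "delta_dense G \<longleftrightarrow> (\<forall>i\<in>{2..num_segments G}. segment_start G i > 1)"

definition cart_prod :: "'a ugraph \<Rightarrow> 'b ugraph \<Rightarrow> ('a \<times> 'b) ugraph" where
  "cart_prod H G =
     \<lparr>verts = verts H \<times> verts G,
      edges = {{(x, y), (u, v)} | x y u v.
        (x, y) \<in> verts H \<times> verts G \<and> (u, v) \<in> verts H \<times> verts G \<and>
        (x = u \<and> {y, v} \<in> edges G \<or> {x, u} \<in> edges H \<and> y = v)}\<rparr>"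

definition relabel :: "('a \<Rightarrow> 'b) \<Rightarrow> 'a ugraph \<Rightarrow> 'b ugraph" where
  "relabel f G = \<lparr>verts = f ` verts G, edges = (\<lambda>e. f ` e) ` edges G\<rparr>"

text \<open>The vertices of the \<open>d\<close>-th power are lists of length \<open>d\<close>, so that all powers share one type:
  the pair \<open>(x, xs)\<close> of \<open>G \<box> G\<^sup>d\<close> is renamed to \<open>x # xs\<close>. The zeroth power is a single vertex.\<close>

primrec cart_power :: "'a ugraph \<Rightarrow> nat \<Rightarrow> 'a list ugraph" where
  "cart_power G 0 = \<lparr>verts = {[]}, edges = {}\<rparr>"
| "cart_power G (Suc d) = relabel (\<lambda>(x, xs). x # xs) (cart_prod G (cart_power G d))"

lemma verts_cart_power: "verts (cart_power G d) = {xs. length xs = d \<and> set xs \<subseteq> verts G}"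
proof (induction d)
  case (Suc d)
  then show ?case
    by (auto simp: relabel_def cart_prod_def image_iff length_Suc_conv)
qed auto

end

theory Submission imports Defs "HOL-Library.Product_Lexorder" "HOL-Library.List_Lexorder" begin

text \<open>
  Let \<open>G\<close> have \<open>n\<close> vertices, numbered along a nested chain of optimal sets. Density says that
  \<open>\<delta>(m) \<ge> 2\<close> for all \<open>m \<ge> 3\<close>, and this forces any nested chain of optimal sets of \<open>G\<^sup>2\<close> to fill, up to
  swapping the coordinates, one row after the other. Hence the initial segments of the
  lexicographic order are optimal in \<open>G\<^sup>2\<close>.

  The lexicographic order is then optimal in every power, by the local-global principle of
  Ahlswede and Cai, applied to \<open>G \<box> G\<^bsup>d-2\<^esup> \<box> G\<close>: among the optimal sets of a given size take one with
  least sum of lexicographic ranks. Compressing the slices that fix one of the three coordinates shows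
  that all these slices are initial segments. If the set is not itself an initial segment, then it
  consists of all vertices below some \<open>(p, y, z)\<close> with \<open>y\<close> maximal, together with the vertices
  \<open>(p', y', w)\<close>, \<open>w \<le> z'\<close>, where \<open>p'\<close> is the successor of \<open>p\<close> and \<open>y'\<close> is minimal. Counting every edge
  at its upper end, the comparison with the initial segment reduces to \<open>G\<^sup>2\<close>.
\<close>

text \<open>Edges are counted as ordered pairs, that is, twice.\<close>

definition arc_count :: "('a \<Rightarrow> 'a \<Rightarrow> bool) \<Rightarrow> 'a set \<Rightarrow> nat" where
  "arc_count R A = card {(x, y). x \<in> A \<and> y \<in> A \<and> R x y}"

definition nbr_count :: "('a \<Rightarrow> 'a \<Rightarrow> bool) \<Rightarrow> 'a set \<Rightarrow> 'a \<Rightarrow> nat" where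
  "nbr_count R A x = card {y \<in> A. R x y}"

section \<open>Box products, and arc counts of unions, images and products\<close>

text \<open>The adjacency of \<open>cart_prod\<close> as a bare relation on pairs. Vertex sets are
  kept separately, so factors of any type, products included, can be combined and restricted to
  subsets.\<close>

definition box :: "('a \<Rightarrow> 'a \<Rightarrow> bool) \<Rightarrow> ('b \<Rightarrow> 'b \<Rightarrow> bool) \<Rightarrow> 'a \<times> 'b \<Rightarrow> 'a \<times> 'b \<Rightarrow> bool" where
  "box R S p q \<longleftrightarrow> fst p = fst q \<and> S (snd p) (snd q) \<or> R (fst p) (fst q) \<and> snd p = snd q"

lemma box_Pair [simp]: "box R S (x, y) (u, v) \<longleftrightarrow> x = u \<and> S y v \<or> R x u \<and> y = v"
  by (simp add: box_def)

lemma symp_box: "symp R \<Longrightarrow> symp S \<Longrightarrow> symp (box R S)"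
  unfolding symp_def by auto

lemma irreflp_box: "irreflp R \<Longrightarrow> irreflp S \<Longrightarrow> irreflp (box R S)"
  unfolding irreflp_def by auto

lemma arc_count_eq_sum: "finite A \<Longrightarrow> arc_count R A = (\<Sum>x\<in>A. nbr_count R A x)"
proof -
  assume "finite A"
  moreover have "{(x, y). x \<in> A \<and> y \<in> A \<and> R x y} = Sigma A (\<lambda>x. {y \<in> A. R x y})" by auto
  ultimately show ?thesis by (simp add: arc_count_def nbr_count_def)
qed

lemma nbr_count_Un: "finite A \<Longrightarrow> finite B \<Longrightarrow> A \<inter> B = {} \<Longrightarrow>
    nbr_count R (A \<union> B) x = nbr_count R A x + nbr_count R B x"
proof -
  assume "finite A" "finite B" "A \<inter> B = {}"
  moreover have "{y \<in> A \<union> B. R x y} = {y \<in> A. R x y} \<union> {y \<in> B. R x y}" by auto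
  ultimately show ?thesis unfolding nbr_count_def by (simp add: card_Un_disjoint disjoint_iff)
qed

text \<open>Double counting of the adjacent pairs with one end in \<open>A\<close> and the other in
  \<open>B\<close>.\<close>

lemma sum_nbr_count_commute:
  assumes "finite A" "finite B" "symp R"
  shows "(\<Sum>x\<in>A. nbr_count R B x) = (\<Sum>x\<in>B. nbr_count R A x)"
proof -
  have eq: "nbr_count R C x = (\<Sum>y\<in>C. if R x y then 1 else 0)" if "finite C" for C x
    using that by (simp add: nbr_count_def sum.If_cases Int_def)
  have "(\<Sum>x\<in>A. nbr_count R B x) = (\<Sum>x\<in>A. \<Sum>y\<in>B. if R x y then 1 else 0)"
    using assms by (simp add: eq)
  also have "\<dots> = (\<Sum>y\<in>B. \<Sum>x\<in>A. if R y x then 1 else 0)"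
    by (subst sum.swap) (use \<open>symp R\<close> in \<open>auto intro!: sum.cong dest: sympD\<close>)
  finally show ?thesis using assms by (simp add: eq)
qed

lemma arc_count_Un:
  assumes "finite A" "finite B" "A \<inter> B = {}" "symp R"
  shows "arc_count R (A \<union> B) = arc_count R A + arc_count R B + 2 * (\<Sum>b\<in>B. nbr_count R A b)"
  using assms sum_nbr_count_commute[of A B R]
  by (simp add: arc_count_eq_sum sum.union_disjoint nbr_count_Un sum.distrib)

lemma arc_count_insert:
  assumes "finite A" "x \<notin> A" "symp R" "irreflp R"
  shows "arc_count R (insert x A) = arc_count R A + 2 * nbr_count R A x"
proof -
  have "{(u, v). u \<in> {x} \<and> v \<in> {x} \<and> R u v} = {}" using \<open>irreflp R\<close> by (auto simp: irreflp_def)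
  then have "arc_count R {x} = 0" by (simp only: arc_count_def card.empty)
  then show ?thesis using arc_count_Un[of A "{x}" R] assms by simp
qed

lemma arc_count_image:
  assumes "inj_on f A" and "\<And>x y. x \<in> A \<Longrightarrow> y \<in> A \<Longrightarrow> S (f x) (f y) \<longleftrightarrow> R x y"
  shows "arc_count S (f ` A) = arc_count R A"
proof -
  have "{(x, y). x \<in> f ` A \<and> y \<in> f ` A \<and> S x y} = map_prod f f ` {(x, y). x \<in> A \<and> y \<in> A \<and> R x y}"
    using assms(2) by (force simp: image_iff)
  moreover have "inj_on (map_prod f f) {(x, y). x \<in> A \<and> y \<in> A \<and> R x y}"
    using assms(1) by (auto simp: inj_on_def)
  ultimately show ?thesis by (simp add: arc_count_def card_image)
qed

text \<open>Arcs are sorted by direction. Those that keep the first coordinate lie inside one slice;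
  those that keep the second lead from the slice over \<open>x\<close> to the slice over an
  \<open>R\<close>-neighbour \<open>u\<close>, one for each common element of the two slices.
  Irreflexivity of \<open>R\<close> makes the two kinds disjoint.\<close>

lemma arc_count_box:
  assumes "finite V" "finite W" "A \<subseteq> V \<times> W" "irreflp R"
  shows "arc_count (box R S) A = (\<Sum>x\<in>V. arc_count S (A `` {x}))
    + (\<Sum>x\<in>V. \<Sum>u\<in>{u \<in> V. R x u}. card (A `` {x} \<inter> A `` {u}))"
proof -
  let ?P = "Sigma V (\<lambda>x. {(y, v). y \<in> A `` {x} \<and> v \<in> A `` {x} \<and> S y v})"
  let ?Q = "Sigma V (\<lambda>x. Sigma {u \<in> V. R x u} (\<lambda>u. A `` {x} \<inter> A `` {u}))"
  let ?f = "\<lambda>(x, y, v). ((x, y), (x, v))"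
  let ?g = "\<lambda>(x, u, y). ((x, y), (u, y))"
  have fin: "finite (A `` {x})" for x
    using assms by (meson finite_Image finite_SigmaI finite_subset)
  have finP: "finite {(y, v). y \<in> A `` {x} \<and> v \<in> A `` {x} \<and> S y v}" for x
    by (rule finite_subset[of _ "A `` {x} \<times> A `` {x}"]) (auto simp: fin)
  have eq: "{(p, q). p \<in> A \<and> q \<in> A \<and> box R S p q} = ?f ` ?P \<union> ?g ` ?Q"
    using assms(3) by (force simp: image_iff)
  have "?f ` ?P \<inter> ?g ` ?Q = {}" using \<open>irreflp R\<close> by (auto simp: irreflp_def)
  moreover have "finite ?P" using assms finP by blast
  moreover have "finite ?Q" using assms(1) fin by (intro finite_SigmaI) auto
  ultimately have "card (?f ` ?P \<union> ?g ` ?Q) = card (?f ` ?P) + card (?g ` ?Q)"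
    by (intro card_Un_disjoint) auto
  also have "card (?f ` ?P) = card ?P" by (intro card_image) (auto simp: inj_on_def)
  also have "card ?P = (\<Sum>x\<in>V. arc_count S (A `` {x}))"
    using assms finP by (subst card_SigmaI) (auto simp: arc_count_def)
  also have "card (?g ` ?Q) = card ?Q" by (intro card_image) (auto simp: inj_on_def)
  also have "card ?Q = (\<Sum>x\<in>V. \<Sum>u\<in>{u \<in> V. R x u}. card (A `` {x} \<inter> A `` {u}))"
    using assms fin by (subst card_SigmaI) (auto intro!: sum.cong simp: card_SigmaI)
  finally show ?thesis unfolding arc_count_def[of "box R S"] eq .
qed

subsection \<open>Initial segments\<close>

definition initial :: "'a::linorder set \<Rightarrow> 'a set \<Rightarrow> bool" where
  "initial V I \<longleftrightarrow> I \<subseteq> V \<and> (\<forall>x\<in>I. \<forall>y\<in>V. y < x \<longrightarrow> y \<in> I)"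

definition rank :: "'a::linorder set \<Rightarrow> 'a \<Rightarrow> nat" where
  "rank V x = card {y \<in> V. y < x}"

definition seg :: "'a::linorder set \<Rightarrow> nat \<Rightarrow> 'a set" where
  "seg V c = {x \<in> V. rank V x < c}"

text \<open>The linear order plays the part of nested solutions: the initial segments of a finite
  \<open>V\<close> form a chain with one set of each size up to \<open>card V\<close>, and all of
  them are required to be optimal.\<close>

definition initial_optimal :: "('a::linorder \<Rightarrow> 'a \<Rightarrow> bool) \<Rightarrow> 'a set \<Rightarrow> bool" where
  "initial_optimal R V \<longleftrightarrow>
     (\<forall>I A. initial V I \<longrightarrow> A \<subseteq> V \<longrightarrow> card A = card I \<longrightarrow> arc_count R A \<le> arc_count R I)"

lemma initial_optimalD:
  "initial_optimal R V \<Longrightarrow> initial V I \<Longrightarrow> A \<subseteq> V \<Longrightarrow> card A = card I \<Longrightarrow>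
    arc_count R A \<le> arc_count R I"
  unfolding initial_optimal_def by blast

lemma initialD: "initial V I \<Longrightarrow> x \<in> I \<Longrightarrow> y \<in> V \<Longrightarrow> y < x \<Longrightarrow> y \<in> I"
  unfolding initial_def by blast

lemma initial_subset: "initial V I \<Longrightarrow> I \<subseteq> V"
  unfolding initial_def by blast

lemma rank_strict_mono: "finite V \<Longrightarrow> strict_mono_on V (rank V)"
  unfolding rank_def
  by (intro strict_mono_onI psubset_card_mono) (auto intro: less_trans)

lemma bij_betw_rank: "finite V \<Longrightarrow> bij_betw (rank V) V {..<card V}"
proof -
  assume fin: "finite V"
  have inj: "inj_on (rank V) V" using rank_strict_mono[OF fin] by (rule strict_mono_on_imp_inj_on)
  have "rank V ` V \<subseteq> {..<card V}"
    using fin unfolding rank_def by (auto intro!: psubset_card_mono)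
  then have "rank V ` V = {..<card V}"
    using card_image[OF inj] by (intro card_subset_eq) auto
  with inj show ?thesis by (simp add: bij_betw_def)
qed

lemma initial_seg: "finite V \<Longrightarrow> initial V (seg V c)"
  unfolding initial_def seg_def using rank_strict_mono[of V]
  by (auto dest: strict_mono_onD)

lemma seg_mono: "c \<le> d \<Longrightarrow> seg V c \<subseteq> seg V d"
  unfolding seg_def by auto

lemma card_seg: "finite V \<Longrightarrow> c \<le> card V \<Longrightarrow> card (seg V c) = c"
proof -
  assume fin: "finite V" and c: "c \<le> card V"
  note bij = bij_betw_rank[OF fin]
  have "rank V ` seg V c = {..<c}"
  proof (intro equalityI subsetI)
    fix i assume "i \<in> {..<c}"
    then have "i \<in> rank V ` V" using bij c by (auto simp: bij_betw_def)
    then show "i \<in> rank V ` seg V c" using \<open>i \<in> {..<c}\<close> by (auto simp: seg_def)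
  qed (auto simp: seg_def)
  moreover have "inj_on (rank V) (seg V c)"
    using bij by (auto simp: bij_betw_def seg_def intro: inj_on_subset)
  ultimately show ?thesis using card_image by fastforce
qed

lemma initial_linear: "initial V I \<Longrightarrow> initial V J \<Longrightarrow> I \<subseteq> J \<or> J \<subseteq> I"
proof (rule ccontr)
  assume "initial V I" "initial V J" "\<not> (I \<subseteq> J \<or> J \<subseteq> I)"
  then obtain x y where xy: "x \<in> I" "x \<notin> J" "y \<in> J" "y \<notin> I" by blast
  with \<open>initial V I\<close> \<open>initial V J\<close> show False
    by (metis initialD initial_subset linorder_neqE subsetD)
qed

lemma initial_card_le: "finite V \<Longrightarrow> initial V I \<Longrightarrow> initial V J \<Longrightarrow> card I \<le> card J \<Longrightarrow> I \<subseteq> J"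
  by (metis card_seteq finite_subset initial_linear initial_subset order_refl)

text \<open>\<open>I - A\<close> and \<open>A - I\<close> are nonempty and of equal size, and as
  \<open>I\<close> is initial, every element of the former lies below every element of the
  latter.\<close>

lemma initial_sum_less:
  fixes f :: "'a::linorder \<Rightarrow> nat"
  assumes "finite V" "initial V I" "A \<subseteq> V" "card A = card I" "strict_mono_on V f" "A \<noteq> I"
  shows "sum f I < sum f A"
proof -
  have IV: "I \<subseteq> V" using assms(2) by (rule initial_subset)
  have fin: "finite I" "finite A" using assms(1,3) IV finite_subset by auto
  have dI: "card (I - A) = card I - card (I \<inter> A)" and dA: "card (A - I) = card A - card (I \<inter> A)"
    using fin by (auto simp: card_Diff_subset_Int Int_commute)
  have c: "card (I - A) = card (A - I)" using dI dA assms(4) by simp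
  have ne: "I - A \<noteq> {}"
  proof
    assume e: "I - A = {}"
    then have "card (A - I) = 0" using c by (metis card.empty)
    then have "A \<subseteq> I" using fin by auto
    with e assms(6) show False by auto
  qed
  have less: "f x < f y" if "x \<in> I - A" "y \<in> A - I" for x y
  proof -
    have "\<not> y < x" using initialD[OF assms(2), of x y] that assms(3) by auto
    moreover have "x \<noteq> y" using that by auto
    ultimately have "x < y" by auto
    then show ?thesis using assms(3,5) IV that by (auto dest: strict_mono_onD)
  qed
  \<comment> \<open>\<open>M\<close> separates the two differences: \<open>f\<close> is at most
    \<open>M\<close> on \<open>I - A\<close> and at least \<open>M + 1\<close> on
    \<open>A - I\<close>.\<close>
  define M where "M = Max (f ` (I - A))"
  have M: "f x \<le> M" if "x \<in> I - A" for x using that fin unfolding M_def by auto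
  have "M \<in> f ` (I - A)" unfolding M_def using fin ne by (intro Max_in) auto
  then have M': "Suc M \<le> f y" if "y \<in> A - I" for y using less that by fastforce
  have "sum f (I - A) \<le> card (I - A) * M" using sum_bounded_above[of "I - A" f M] M by simp
  also have "\<dots> < card (A - I) * Suc M"
  proof -
    have "card (I - A) > 0" using ne fin by (meson card_gt_0_iff finite_Diff)
    then show ?thesis using c by simp
  qed
  also have "\<dots> \<le> sum f (A - I)" using sum_bounded_below[of "A - I" "Suc M" f] M' by simp
  finally have "sum f (I - A) < sum f (A - I)" .
  moreover have "sum f I = sum f (I \<inter> A) + sum f (I - A)" using fin by (intro sum.Int_Diff)
  moreover have "sum f A = sum f (A \<inter> I) + sum f (A - I)" using fin by (intro sum.Int_Diff)
  ultimately show ?thesis by (simp add: Int_commute)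
qed

section \<open>Compression of slices\<close>

text \<open>Every slice of \<open>B\<close> over a point of \<open>V\<close> is replaced by the
  initial segment of \<open>W\<close> of the same size. Inside the slices no arcs are lost, by
  \<open>opt\<close>. The gap \<open>u < v\<close> over \<open>h\<close> guarantees that some slice
  changes, which lowers the sum of \<open>f\<close>. The weight \<open>f\<close> is left general so
  that ranks in another order can be inserted.\<close>

lemma compression:
  fixes V :: "'a set" and W :: "'b::linorder set"
  assumes fin: "finite V" "finite W" and opt: "initial_optimal S W" and irr: "irreflp R"
    and B: "B \<subseteq> V \<times> W" and uv: "(h, u) \<notin> B" "(h, v) \<in> B" "u \<in> W" "u < v"
  obtains B' where "B' \<subseteq> V \<times> W" "card B' = card B"
    "arc_count (box R S) B \<le> arc_count (box R S) B'"
    "\<And>f :: _ \<Rightarrow> nat. (\<And>x. x \<in> V \<Longrightarrow> strict_mono_on W (\<lambda>y. f (x, y))) \<Longrightarrow> sum f B' < sum f B"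
proof -
  define C where "C x = seg W (card (B `` {x}))" for x
  define B' where "B' = Sigma V C"
  have BW: "B `` {x} \<subseteq> W" for x using B by auto
  have finB: "finite (B `` {x})" for x using BW fin finite_subset by blast
  have cardC: "card (C x) = card (B `` {x})" for x
    unfolding C_def using fin BW by (simp add: card_seg card_mono)
  have iniC: "initial W (C x)" for x unfolding C_def using fin(2) by (rule initial_seg)
  have CW: "C x \<subseteq> W" for x using iniC initial_subset by blast
  have finC: "finite (C x)" for x using CW fin finite_subset by blast
  have BS: "B = Sigma V (\<lambda>x. B `` {x})" using B by auto
  have B'i: "B' `` {x} = C x" if "x \<in> V" for x using that by (auto simp: B'_def)
  have 1: "B' \<subseteq> V \<times> W" using CW by (auto simp: B'_def)
  have 2: "card B' = card B"
    by (subst BS, unfold B'_def) (simp add: card_SigmaI fin finB finC cardC)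
  \<comment> \<open>Edges between different slices do not get lost because initial segments form a chain.\<close>
  have le: "card (B `` {x} \<inter> B `` {u}) \<le> card (C x \<inter> C u)" for x u
  proof -
    have "C x \<inter> C u = C x \<or> C x \<inter> C u = C u"
      using seg_mono[of _ _ W] unfolding C_def by (metis inf.absorb1 inf.absorb2 linear)
    moreover have "card (B `` {x} \<inter> B `` {u}) \<le> card (B `` {x})"
      "card (B `` {x} \<inter> B `` {u}) \<le> card (B `` {u})" using finB by (auto intro: card_mono)
    ultimately show ?thesis using cardC by metis
  qed
  have 3: "arc_count (box R S) B \<le> arc_count (box R S) B'"
    unfolding arc_count_box[OF fin B irr] arc_count_box[OF fin 1 irr]
    by (intro add_mono sum_mono)
      (auto simp: B'i cardC intro!: le initial_optimalD[OF opt iniC BW])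
  have 4: "sum f B' < sum f B" if f: "\<And>x. x \<in> V \<Longrightarrow> strict_mono_on W (\<lambda>y. f (x, y))"
    for f :: "_ \<Rightarrow> nat"
  proof -
    have hV: "h \<in> V" using uv B by auto
    have less: "sum (\<lambda>y. f (x, y)) (C x) < sum (\<lambda>y. f (x, y)) (B `` {x})"
      if "x \<in> V" "B `` {x} \<noteq> C x" for x
      using initial_sum_less[OF fin(2) iniC BW _ f] that cardC by metis
    have le: "sum (\<lambda>y. f (x, y)) (C x) \<le> sum (\<lambda>y. f (x, y)) (B `` {x})" if "x \<in> V" for x
      using less[OF that] by (cases "B `` {x} = C x") auto
    have "B `` {h} \<noteq> C h"
    proof
      assume "B `` {h} = C h"
      then have "v \<in> C h" "u \<notin> C h" using uv by auto
      then show False using iniC uv initialD by blast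
    qed
    then have "(\<Sum>x\<in>V. sum (\<lambda>y. f (x, y)) (C x)) < (\<Sum>x\<in>V. sum (\<lambda>y. f (x, y)) (B `` {x}))"
      using fin hV less le by (intro sum_strict_mono_ex1) blast+
    then show ?thesis
      by (subst BS, unfold B'_def) (simp add: sum.Sigma fin finB finC)
  qed
  show thesis using that[OF 1 2 3 4] by blast
qed

subsection \<open>Back degrees\<close>

definition back_degree :: "('a::linorder \<Rightarrow> 'a \<Rightarrow> bool) \<Rightarrow> 'a set \<Rightarrow> 'a \<Rightarrow> nat" where
  "back_degree R V x = card {y \<in> V. y < x \<and> R x y}"

lemma arc_count_back_degree:
  assumes "finite A" "symp R" "irreflp R"
  shows "arc_count R A = 2 * (\<Sum>x\<in>A. back_degree R A x)"
proof -
  let ?D = "Sigma A (\<lambda>x. {y \<in> A. y < x \<and> R x y})"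
  have "{(x, y). x \<in> A \<and> y \<in> A \<and> R x y} = ?D \<union> prod.swap ` ?D"
    using assms(2,3) by (auto simp: image_iff symp_def irreflp_def) (metis neqE)
  moreover have "?D \<inter> prod.swap ` ?D = {}" by auto
  moreover have "finite ?D" using assms by auto
  moreover have "card (prod.swap ` ?D) = card ?D" by (intro card_image) auto
  moreover have "card ?D = (\<Sum>x\<in>A. back_degree R A x)"
    unfolding back_degree_def using assms by (intro card_SigmaI) auto
  ultimately show ?thesis by (simp add: arc_count_def card_Un_disjoint)
qed

lemma arc_count_le_back_degree:
  assumes "finite V" "A \<subseteq> V" "symp R" "irreflp R"
  shows "arc_count R A \<le> 2 * (\<Sum>x\<in>A. back_degree R V x)"
proof -
  have "finite A" using assms finite_subset by auto
  moreover have "back_degree R A x \<le> back_degree R V x" for x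
    unfolding back_degree_def using assms by (intro card_mono) auto
  ultimately show ?thesis using assms by (simp add: arc_count_back_degree sum_mono)
qed

text \<open>Each edge is counted at its upper end. \<open>A\<close> need not be initial: it is
  enough that it contains the lower neighbours of its elements.\<close>

lemma arc_count_eq_back_degree:
  assumes "finite V" "A \<subseteq> V" "symp R" "irreflp R"
    and down: "\<And>x y. x \<in> A \<Longrightarrow> y \<in> V \<Longrightarrow> y < x \<Longrightarrow> R x y \<Longrightarrow> y \<in> A"
  shows "arc_count R A = 2 * (\<Sum>x\<in>A. back_degree R V x)"
proof -
  have "finite A" using assms(1,2) finite_subset by auto
  moreover have "{y \<in> A. y < x \<and> R x y} = {y \<in> V. y < x \<and> R x y}" if "x \<in> A" for x
    using that assms by auto
  ultimately show ?thesis using assms by (simp add: arc_count_back_degree back_degree_def)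
qed

text \<open>A neighbour of \<open>(x, y)\<close> differs from it in one coordinate, and it is
  lexicographically smaller iff that coordinate is smaller.\<close>

lemma back_degree_box:
  assumes "finite V" "finite W" "x \<in> V" "y \<in> W"
    and "irreflp R"
  shows "back_degree (box R S) (V \<times> W) (x, y) = back_degree R V x + back_degree S W y"
proof -
  let ?P = "{u \<in> V. u < x \<and> R x u}" and ?Q = "{v \<in> W. v < y \<and> S y v}"
  have "{q \<in> V \<times> W. q < (x, y) \<and> box R S (x, y) q} = (\<lambda>u. (u, y)) ` ?P \<union> Pair x ` ?Q"
    using assms by (auto simp: irreflp_def)
  moreover have "(\<lambda>u. (u, y)) ` ?P \<inter> Pair x ` ?Q = {}" by auto
  ultimately show ?thesis unfolding back_degree_def using assms
    by (simp add: card_Un_disjoint card_image inj_on_def)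
qed

subsection \<open>The local-global principle\<close>

text \<open>Compression in a vertex set \<open>V\<close> that \<open>\<phi>\<close> splits into a
  factor \<open>H\<close>, held fixed, and a factor \<open>K\<close>. As \<open>\<phi>\<close> only
  has to increase with its second component, any coordinate of a triple can be the fixed one. The
  weight is the rank in \<open>V\<close>.\<close>

lemma compression_transport:
  fixes K :: "'b::linorder set" and V :: "'c::linorder set"
  assumes fin: "finite H" "finite K" and opt: "initial_optimal S K" and irr: "irreflp R"
    and bij: "bij_betw \<phi> (H \<times> K) V"
    and E: "\<And>p q. p \<in> H \<times> K \<Longrightarrow> q \<in> H \<times> K \<Longrightarrow> E (\<phi> p) (\<phi> q) \<longleftrightarrow> box R S p q"
    and mono: "\<And>h. h \<in> H \<Longrightarrow> strict_mono_on K (\<lambda>k. \<phi> (h, k))"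
    and B: "B \<subseteq> V" and uv: "\<phi> (h, u) \<notin> B" "\<phi> (h, v) \<in> B" "h \<in> H" "u \<in> K" "v \<in> K" "u < v"
  obtains B' where "B' \<subseteq> V" "card B' = card B" "arc_count E B \<le> arc_count E B'"
    "sum (rank V) B' < sum (rank V) B"
proof -
  define C where "C = {p \<in> H \<times> K. \<phi> p \<in> B}"
  have inj: "inj_on \<phi> (H \<times> K)" and im: "\<phi> ` (H \<times> K) = V"
    using bij by (auto simp: bij_betw_def)
  have finV: "finite V" using fin im by (metis finite_SigmaI finite_imageI)
  have CB: "\<phi> ` C = B" using im B by (auto simp: C_def)
  have CHK: "C \<subseteq> H \<times> K" by (auto simp: C_def)
  have "(h, u) \<notin> C" "(h, v) \<in> C" using uv by (auto simp: C_def)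
  from compression[OF fin opt irr CHK this uv(4) uv(6)]
  obtain C' where C': "C' \<subseteq> H \<times> K" "card C' = card C"
    "arc_count (box R S) C \<le> arc_count (box R S) C'"
    "\<And>f :: _ \<Rightarrow> nat. (\<And>x. x \<in> H \<Longrightarrow> strict_mono_on K (\<lambda>y. f (x, y))) \<Longrightarrow> sum f C' < sum f C"
    by blast
  have injs: "inj_on \<phi> C" "inj_on \<phi> C'" using inj CHK C'(1) inj_on_subset by blast+
  have "strict_mono_on K (\<lambda>k. rank V (\<phi> (x, k)))" if "x \<in> H" for x
  proof (rule strict_mono_onI)
    fix r s assume "r \<in> K" "s \<in> K" "r < s"
    then have "\<phi> (x, r) < \<phi> (x, s)" "\<phi> (x, r) \<in> V" "\<phi> (x, s) \<in> V"
      using strict_mono_onD[OF mono[OF that]] im that by auto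
    then show "rank V (\<phi> (x, r)) < rank V (\<phi> (x, s))"
      using rank_strict_mono[OF finV] by (auto dest: strict_mono_onD)
  qed
  from C'(4)[of "\<lambda>p. rank V (\<phi> p)", OF this]
  have "sum (rank V) (\<phi> ` C') < sum (rank V) (\<phi> ` C)"
    using injs by (simp add: sum.reindex)
  moreover have "\<phi> ` C' \<subseteq> V" using C'(1) im by blast
  moreover have "card (\<phi> ` C') = card B" using CB injs C'(2) card_image by metis
  moreover have "arc_count E B = arc_count (box R S) C"
    unfolding CB[symmetric] using injs CHK by (intro arc_count_image E) auto
  moreover have "arc_count E (\<phi> ` C') = arc_count (box R S) C'"
    using injs C'(1) by (intro arc_count_image E) auto
  ultimately show thesis using that[of "\<phi> ` C'"] C'(3) CB by simp
qed

lemma back_degree_Min: "(\<And>v. v \<in> V \<Longrightarrow> y \<le> v) \<Longrightarrow> back_degree R V y = 0"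
  unfolding back_degree_def by (metis (no_types, lifting) card.empty empty_Collect_eq leD)

text \<open>Each of the three hypotheses on pairs allows compression of the slices that fix the
  remaining coordinate. \<open>optXZ\<close> is used a second time, for the one shape of set that
  survives all compressions without being initial.\<close>

lemma initial_optimal_three_factors:
  fixes X :: "'a::linorder set" and Y :: "'b::linorder set" and Z :: "'c::linorder set"
  assumes fin: "finite X" "finite Y" "finite Z"
    and sym: "symp P" "symp Q" "symp R" and irr: "irreflp P" "irreflp Q" "irreflp R"
    and optXY: "initial_optimal (box P Q) (X \<times> Y)"
    and optYZ: "initial_optimal (box Q R) (Y \<times> Z)"
    and optXZ: "initial_optimal (box P R) (X \<times> Z)"
  shows "initial_optimal (box P (box Q R)) (X \<times> Y \<times> Z)"
proof -
  let ?V = "X \<times> Y \<times> Z" and ?E = "box P (box Q R)"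
  have finV: "finite ?V" using fin by simp
  have symE: "symp ?E" and irrE: "irreflp ?E" using sym irr by (auto intro: symp_box irreflp_box)
  have "arc_count ?E A \<le> arc_count ?E I"
    if I: "initial ?V I" and A: "A \<subseteq> ?V" "card A = card I" for I A
  proof -
    let ?c = "\<lambda>B. B \<subseteq> ?V \<and> card B = card I \<and> arc_count ?E A \<le> arc_count ?E B"
    \<comment> \<open>The sum of ranks is a potential: compression keeps the size, loses no arcs and
      lowers the sum, so none applies to the minimiser \<open>B\<close>.\<close>
    have "?c A" using A by simp
    from ex_has_least_nat[of ?c, OF this, of "sum (rank ?V)"]
    obtain B where B: "B \<subseteq> ?V" "card B = card I" "arc_count ?E A \<le> arc_count ?E B"
      and least: "\<And>B'. ?c B' \<Longrightarrow> sum (rank ?V) B \<le> sum (rank ?V) B'" by blast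
    have noB': False if "B' \<subseteq> ?V" "card B' = card B" "arc_count ?E B \<le> arc_count ?E B'"
      "sum (rank ?V) B' < sum (rank ?V) B" for B'
      using least[of B'] that B by fastforce
    \<comment> \<open>The slices of \<open>B\<close> with the first, third or second coordinate
      fixed are initial in the lexicographic order of the other two. In \<open>sz\<close> and
      \<open>sy\<close>, \<open>\<phi>\<close> brings the fixed coordinate to the front.\<close>
    have sx: False if "(x, y, z) \<notin> B" "(x, y', z') \<in> B" "y \<in> Y" "z \<in> Z" "(y, z) < (y', z')"
      for x y z y' z'
      by (rule compression_transport[where \<phi> = id and h = x and u = "(y, z)" and v = "(y', z')"
            and E = ?E and B = B and V = ?V, OF fin(1) _ optYZ irr(1)])
        (use that fin B noB' in \<open>auto intro: strict_mono_onI\<close>)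
    have sz: False if "(x, y, z) \<notin> B" "(x', y', z) \<in> B" "x \<in> X" "y \<in> Y" "(x, y) < (x', y')"
      for x y z x' y'
      by (rule compression_transport[where \<phi> = "\<lambda>(z, x, y). (x, y, z)" and h = z and u = "(x, y)"
            and v = "(x', y')" and E = ?E and B = B and V = ?V, OF fin(3) _ optXY irr(3)])
        (use that fin B noB' in \<open>auto intro!: strict_mono_onI simp: bij_betw_def inj_on_def image_iff\<close>)
    have sy: False if "(x, y, z) \<notin> B" "(x', y, z') \<in> B" "x \<in> X" "z \<in> Z" "(x, z) < (x', z')"
      for x y z x' z'
      by (rule compression_transport[where \<phi> = "\<lambda>(y, x, z). (x, y, z)" and h = y and u = "(x, z)"
            and v = "(x', z')" and E = ?E and B = B and V = ?V, OF fin(2) _ optXZ irr(2)])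
        (use that fin B noB' in \<open>auto intro!: strict_mono_onI simp: bij_betw_def inj_on_def image_iff\<close>)
    have eqI: "J = I" if "initial ?V J" "card J = card I" for J
      using initial_card_le[OF finV that(1) I] initial_card_le[OF finV I that(1)] that(2) by auto
    show ?thesis
    proof (cases "initial ?V B")
      case True
      then show ?thesis using eqI B by auto
    next
      case False
      then obtain v u where vu: "v \<in> B" "u \<in> ?V - B" "u < v"
        using B(1) unfolding initial_def by blast
      have finB: "finite B" using B(1) finV finite_subset by blast
      obtain p y z where b: "(p, y, z) = Min (?V - B)" by (metis prod_cases3)
      obtain p' y' z' where a: "(p', y', z') = Max B" by (metis prod_cases3)
      have bin: "(p, y, z) \<in> ?V - B" unfolding b using vu finV by (intro Min_in) auto
      have bmin: "(p, y, z) \<le> w" if "w \<in> ?V - B" for w unfolding b using that finV by simp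
      have ain: "(p', y', z') \<in> B" unfolding a using vu finB by (intro Max_in) auto
      have amax: "w \<le> (p', y', z')" if "w \<in> B" for w unfolding a using that finB by simp
      have ba: "(p, y, z) < (p', y', z')"
        using bmin[OF vu(2)] amax[OF vu(1)] vu(3) by (meson le_less_trans less_le_trans)
      have bV: "p \<in> X" "y \<in> Y" "z \<in> Z" "(p, y, z) \<notin> B" using bin by auto
      have aV: "p' \<in> X" "y' \<in> Y" "z' \<in> Z" using ain B by auto
      \<comment> \<open>Each relation from here to \<open>z' < z\<close> is forced: its negation
        exhibits a missing triple and a larger triple of \<open>B\<close> that share a
        coordinate.\<close>
      have "p \<noteq> p'" using sx[of p y z y' z'] bV ain ba by auto
      then have pp: "p < p'" using ba by auto
      have after_b: "(p, w) \<notin> B" if "(y, z) < w" for w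
        using sx[of p y z "fst w" "snd w"] bV that by auto
      have before_a: "(p', w) \<in> B" if "w < (y', z')" "w \<in> Y \<times> Z" for w
        using sx[of p' "fst w" "snd w" y' z'] ain that by (metis mem_Times_iff prod.collapse)
      have ymax: "w \<le> y" if "w \<in> Y" for w
      proof (rule ccontr)
        assume "\<not> w \<le> y"
        then have "y < w" by simp
        then have "(p, w, z') \<notin> B" using after_b[of "(w, z')"] by auto
        then show False using sz[of p w z' p' y'] ain bV that pp by auto
      qed
      have ymin: "y' \<le> w" if "w \<in> Y" for w
      proof (rule ccontr)
        assume "\<not> y' \<le> w"
        then have "w < y'" by simp
        then have "(p', w, z) \<in> B" using before_a[of "(w, z)"] bV that by auto
        then show False using sz[of p y z p' w] bV pp by auto
      qed
      have no_between: "\<not> (p < w \<and> w < p')" if "w \<in> X" for w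
      proof
        assume w: "p < w \<and> w < p'"
        have "(w, y, z') \<notin> B" using sy[of p y z w z'] bV w by auto
        then show False using sz[of w y z' p' y'] ain bV that w by auto
      qed
      have "y \<noteq> y'" using sy[of p y z p' z'] bV ain pp by auto
      have "z' \<noteq> z" using sz[of p y z p' y'] bV ain pp by auto
      moreover have "\<not> z < z'"
      proof
        assume "z < z'"
        then have "(p, y, z') \<notin> B" using after_b[of "(y, z')"] by auto
        then show False using sz[of p y z' p' y'] ain bV pp by auto
      qed
      ultimately have zz: "z' < z" by auto
      \<comment> \<open>Index 2 marks the objects of \<open>X \<times> Z\<close> obtained by forgetting the middle coordinate.\<close>
      define S where "S = {w \<in> ?V. w < (p, y, z)}"
      define S2 where "S2 = {w \<in> X \<times> Z. w < (p, z)}"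
      define T where "T = (\<lambda>w. (p', y', w)) ` {w \<in> Z. w \<le> z'}"
      define T2 where "T2 = Pair p' ` {w \<in> Z. w \<le> z'}"
      have SB: "S \<subseteq> B" using bmin unfolding S_def by (fastforce simp: not_le[symmetric])
      have TB: "T \<subseteq> B" using ain before_a aV unfolding T_def by (auto simp: le_less)
      have BST: "B = S \<union> T"
      proof (intro equalityI subsetI)
        fix w assume w: "w \<in> B"
        obtain w1 w2 w3 where ww: "w = (w1, w2, w3)" by (metis prod_cases3)
        have wV: "w1 \<in> X" "w2 \<in> Y" "w3 \<in> Z" using w ww B by auto
        show "w \<in> S \<union> T"
        proof (cases "w < (p, y, z)")
          case True then show ?thesis using w B by (auto simp: S_def)
        next
          case False
          have "w \<noteq> (p, y, z)" using w bV by auto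
          then have gt: "(p, y, z) < w" using False by auto
          have le: "w \<le> (p', y', z')" using amax w by simp
          have "w1 \<noteq> p" using after_b[of "(w2, w3)"] gt w ww by auto
          then have "p < w1" using gt ww by auto
          then have "w1 = p'" using no_between[OF wV(1)] le ww by auto
          moreover then have "w2 = y'" "w3 \<le> z'" using le ww ymin[OF wV(2)] by auto
          ultimately show ?thesis using ww wV by (auto simp: T_def)
        qed
      qed (use SB TB in auto)
      have ST: "S \<inter> T = {}" using pp by (auto simp: S_def T_def)
      have ST2: "S2 \<inter> T2 = {}" using pp by (auto simp: S2_def T2_def)
      have finS: "finite S" "finite S2" "finite T" "finite T2"
        using fin by (auto simp: S_def S2_def T_def T2_def)
      have cT: "card T = card {w \<in> Z. w \<le> z'}" "card T2 = card {w \<in> Z. w \<le> z'}"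
        unfolding T_def T2_def by (auto intro!: card_image simp: inj_on_def)
      let ?V2 = "X \<times> Z" and ?E2 = "box P R"
      have finV2: "finite ?V2" using fin by simp
      have symE2: "symp ?E2" and irrE2: "irreflp ?E2"
        using sym irr by (auto intro: symp_box irreflp_box)
      define B2 where "B2 = S2 \<union> T2"
      have B2V: "B2 \<subseteq> ?V2" using aV by (auto simp: B2_def S2_def T2_def)
      define L2 where "L2 = seg ?V2 (card B2)"
      have iL2: "initial ?V2 L2" and cL2: "card L2 = card B2"
        using finV2 B2V by (auto simp: L2_def initial_seg card_seg card_mono)
      have "initial ?V2 S2" by (auto simp: initial_def S2_def)
      then have SL2: "S2 \<subseteq> L2" using initial_card_le[OF finV2 _ iL2] cL2 finS
        by (simp add: B2_def card_mono)
      have "initial ?V2 {w \<in> ?V2. w \<le> (p', z')}" by (auto simp: initial_def)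
      moreover have "B2 \<subseteq> {w \<in> ?V2. w \<le> (p', z')}"
        using aV pp by (auto simp: B2_def S2_def T2_def)
      ultimately have L2a: "L2 \<subseteq> {w \<in> ?V2. w \<le> (p', z')}"
        using finV2 iL2 cL2 by (intro initial_card_le[of ?V2]) (auto intro!: card_mono)
      define N2 where "N2 = L2 - S2"
      have finN2: "finite N2" using L2a finV2 unfolding N2_def
        by (metis (no_types, lifting) finite_Diff finite_subset iL2 initial_subset)
      have cN2: "card N2 = card T2"
        using cL2 SL2 finS ST2 by (simp add: N2_def B2_def card_Diff_subset card_Un_disjoint)
      \<comment> \<open>Between \<open>(p, z)\<close> and \<open>(p', z')\<close> there are only the
        rest of the row of \<open>p\<close> and the start of the row of \<open>p'\<close>, by
        \<open>no_between\<close>.\<close>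
      have N2: "w \<in> N2 \<Longrightarrow> w \<in> ?V2 \<and> (fst w = p \<and> z \<le> snd w \<or> fst w = p' \<and> snd w \<le> z')" for w
        using L2a no_between[of "fst w"] pp unfolding N2_def S2_def by (cases w) fastforce
      \<comment> \<open>Lifts \<open>N2\<close> to triples that directly continue \<open>S\<close>:
        \<open>y\<close> is the largest middle coordinate, \<open>y'\<close> the least, and
        \<open>p'\<close> the successor of \<open>p\<close>. Hence \<open>S\<close> together with
        the lifted set is again initial.\<close>
      define \<psi> where "\<psi> w = (fst w, if fst w = p then y else y', snd w)" for w :: "'a \<times> 'c"
      define N where "N = \<psi> ` N2"
      define L where "L = S \<union> N"
      have inj\<psi>: "inj_on \<psi> N2" by (auto simp: inj_on_def \<psi>_def)
      have cN: "card N = card T" unfolding N_def using inj\<psi> cN2 cT by (simp add: card_image)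
      have SN: "S \<inter> N = {}" using N2 pp by (fastforce simp: N_def S_def \<psi>_def)
      have finN: "finite N" using finN2 by (simp add: N_def)
      have LV: "L \<subseteq> ?V" using N2 bV aV by (fastforce simp: L_def S_def N_def \<psi>_def)
      have cL: "card L = card I"
        using B(2) BST ST SN finS finN cN by (simp add: L_def card_Un_disjoint)
      have "initial ?V L"
        unfolding initial_def
      proof (intro conjI LV ballI impI)
        fix u v assume v: "v \<in> L" and u: "u \<in> ?V" and uv: "u < v"
        show "u \<in> L"
        proof (cases "u < (p, y, z)")
          case True then show ?thesis using u by (simp add: L_def S_def)
        next
          case False
          obtain u1 u2 u3 where uu: "u = (u1, u2, u3)" by (metis prod_cases3)
          have uV: "u1 \<in> X" "u2 \<in> Y" "u3 \<in> Z" using u uu by auto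
          have "v \<notin> S" using False uv by (auto simp: S_def dest: less_trans)
          then obtain v2 where v2: "v2 \<in> N2" "v = \<psi> v2" using v by (auto simp: L_def N_def)
          have v1: "fst v2 = p \<or> fst v2 = p'" using N2[OF v2(1)] by auto
          have "u1 = p \<or> u1 = p'"
            using False uv v1 pp no_between[OF uV(1)] unfolding uu v2(2) \<psi>_def by auto
          then have u\<psi>: "u = \<psi> (u1, u3)"
          proof
            assume "u1 = p"
            then show ?thesis using False ymax[OF uV(2)] by (auto simp: uu \<psi>_def)
          next
            assume u1: "u1 = p'"
            then have "fst v2 = p'" using uv v1 pp by (auto simp: uu v2 \<psi>_def)
            then have "u2 \<le> y'" using uv u1 pp by (auto simp: uu v2 \<psi>_def split: if_splits)
            then show ?thesis using ymin[OF uV(2)] u1 pp by (auto simp: uu \<psi>_def)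
          qed
          have lt: "(u1, u3) < v2" using uv v1 pp unfolding u\<psi> v2(2) \<psi>_def
            by (cases v2) (auto split: if_splits)
          have "v2 \<in> L2" using v2 by (simp add: N2_def)
          then have "(u1, u3) \<in> L2" using initialD[OF iL2 _ _ lt] uV by auto
          moreover have "(u1, u3) \<notin> S2"
            using False pp ymax[OF uV(2)] unfolding uu S2_def by auto
          ultimately have "(u1, u3) \<in> N2" by (simp add: N2_def)
          then show ?thesis using u\<psi> by (auto simp: L_def N_def)
        qed
      qed
      then have LI: "L = I" using eqI cL by simp
      let ?w = "back_degree ?E ?V" and ?w2 = "back_degree ?E2 ?V2"
      have w: "?w (r, s, t) = back_degree P X r + back_degree Q Y s + back_degree R Z t"
        if "r \<in> X" "s \<in> Y" "t \<in> Z" for r s t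
        using that fin irr by (simp add: back_degree_box)
      have w2: "?w2 (r, t) = back_degree P X r + back_degree R Z t" if "r \<in> X" "t \<in> Z" for r t
        using that fin irr by (simp add: back_degree_box)
      \<comment> \<open>As \<open>y'\<close> is least, its back degree vanishes and \<open>T\<close>
        weighs exactly as much as \<open>T2\<close>, whereas \<open>N\<close> weighs at least as
        much as \<open>N2\<close>.\<close>
      have by0: "back_degree Q Y y' = 0" using ymin by (rule back_degree_Min)
      have "sum ?w T = sum ?w2 T2"
        unfolding T_def T2_def using aV by0
        by (simp add: sum.reindex inj_on_def w w2)
      moreover have "sum ?w2 B2 \<le> sum ?w2 L2"
      proof -
        have "arc_count ?E2 B2 \<le> arc_count ?E2 L2"
          using initial_optimalD[OF optXZ iL2 B2V] cL2 by simp
        \<comment> \<open>\<open>B2\<close> lacks \<open>(p, z)\<close> and so is not initial, but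
          it contains the lower neighbours of its elements: such a neighbour of
          \<open>(p', j)\<close> outside the row of \<open>p'\<close> is some \<open>(u1, j)\<close>
          with \<open>u1 \<le> p\<close>, and \<open>j \<le> z' < z\<close> puts it into
          \<open>S2\<close>.\<close>
        moreover have "u \<in> B2" if uv: "v \<in> B2" "u \<in> ?V2" "u < v" "?E2 v u" for u v
        proof (cases "v \<in> S2")
          case True
          then show ?thesis using uv by (auto simp: B2_def S2_def)
        next
          case False
          then obtain j where j: "v = (p', j)" "j \<le> z'" using uv by (auto simp: B2_def T2_def)
          obtain u1 u2 where u: "u = (u1, u2)" by (cases u)
          consider "u1 = p'" "u2 < j" | "u1 < p'" "u2 = j" using uv(3,4) irr(1)
            by (auto simp: u j irreflp_def)
          then show ?thesis
          proof cases
            case 1 then show ?thesis using uv(2) j by (auto simp: u B2_def T2_def)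
          next
            case 2
            then have "u1 \<le> p" using no_between[of u1] uv(2) by (auto simp: u not_le)
            moreover have "u2 < z" using 2 j zz by auto
            ultimately show ?thesis using uv(2) by (auto simp: u B2_def S2_def)
          qed
        qed
        then have "arc_count ?E2 B2 = 2 * sum ?w2 B2"
          by (intro arc_count_eq_back_degree finV2 symE2 irrE2 B2V) auto
        moreover have "arc_count ?E2 L2 = 2 * sum ?w2 L2"
          using initialD[OF iL2] initial_subset[OF iL2]
          by (intro arc_count_eq_back_degree finV2 symE2 irrE2) auto
        ultimately show ?thesis by simp
      qed
      moreover have "sum ?w2 B2 = sum ?w2 S2 + sum ?w2 T2"
        unfolding B2_def using finS ST2 by (intro sum.union_disjoint) auto
      moreover have "sum ?w2 L2 = sum ?w2 S2 + sum ?w2 N2"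
      proof -
        have "L2 = S2 \<union> N2" "S2 \<inter> N2 = {}" using SL2 by (auto simp: N2_def)
        then show ?thesis using finS finN2 by (simp add: sum.union_disjoint)
      qed
      moreover have "sum ?w2 N2 \<le> sum ?w N"
      proof -
        have "?w2 v \<le> ?w (\<psi> v)" if "v \<in> N2" for v
          using N2[OF that] bV aV by (cases v) (auto simp: \<psi>_def w w2)
        then show ?thesis unfolding N_def using inj\<psi> by (simp add: sum.reindex sum_mono)
      qed
      ultimately have "sum ?w T \<le> sum ?w N" by linarith
      then have "sum ?w B \<le> sum ?w L"
        using finS finN ST SN by (simp add: BST L_def sum.union_disjoint)
      moreover have "arc_count ?E B \<le> 2 * sum ?w B"
        using arc_count_le_back_degree[OF finV B(1) symE irrE] .
      moreover have "arc_count ?E L = 2 * sum ?w L"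
        using initialD[OF I] initial_subset[OF I] unfolding LI
        by (intro arc_count_eq_back_degree finV symE irrE) auto
      ultimately show ?thesis using B(3) unfolding LI by linarith
    qed
  qed
  then show ?thesis unfolding initial_optimal_def by blast
qed

subsection \<open>The square\<close>

lemma arc_count_Times:
  assumes "finite T" "finite V" "irreflp R"
  shows "arc_count (box R S) (T \<times> V) = card V * arc_count R T + card T * arc_count S V"
proof -
  have "(T \<times> V) `` {x} = V" if "x \<in> T" for x using that by auto
  then show ?thesis
    using arc_count_box[of T V "T \<times> V" R S] assms
    by (simp add: arc_count_eq_sum[of T] nbr_count_def sum_distrib_left mult.commute)
qed

lemma arc_count_row: "irreflp R \<Longrightarrow> arc_count (box R S) ({y} \<times> C) = arc_count S C"
proof -
  assume "irreflp R"
  then have "arc_count (box R S) (Pair y ` C) = arc_count S C"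
    by (intro arc_count_image) (auto simp: inj_on_def irreflp_def)
  moreover have "Pair y ` C = {y} \<times> C" by auto
  ultimately show ?thesis by simp
qed

lemma arc_count_column: "irreflp S \<Longrightarrow> arc_count (box R S) (C \<times> {z}) = arc_count R C"
proof -
  assume "irreflp S"
  then have "arc_count (box R S) ((\<lambda>y. (y, z)) ` C) = arc_count R C"
    by (intro arc_count_image) (auto simp: inj_on_def irreflp_def)
  moreover have "(\<lambda>y. (y, z)) ` C = C \<times> {z}" by auto
  ultimately show ?thesis by simp
qed

text \<open>\<open>T \<times> V\<close> consists of full rows, and a vertex of another row meets
  them only along its own column.\<close>

lemma nbr_count_Times:
  assumes "y \<notin> T" "z \<in> V"
  shows "nbr_count (box R S) (T \<times> V) (y, z) = nbr_count R T y"
proof -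
  have "{q \<in> T \<times> V. box R S (y, z) q} = (\<lambda>u. (u, z)) ` {u \<in> T. R y u}" using assms by auto
  then show ?thesis by (simp add: nbr_count_def card_image inj_on_def)
qed

lemma nbr_count_row_le_1: "y' \<noteq> y \<Longrightarrow> nbr_count (box R S) ({y} \<times> C) (y', z') \<le> 1"
proof -
  assume "y' \<noteq> y"
  then have "{q \<in> {y} \<times> C. box R S (y', z') q} \<subseteq> {(y, z')}" by auto
  from card_mono[OF _ this] show ?thesis by (simp add: nbr_count_def)
qed

lemma nbr_count_column_le_1: "z' \<noteq> z \<Longrightarrow> nbr_count (box R S) (C \<times> {z}) (y', z') \<le> 1"
proof -
  assume "z' \<noteq> z"
  then have "{q \<in> C \<times> {z}. box R S (y', z') q} \<subseteq> {(y', z)}" by auto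
  from card_mono[OF _ this] show ?thesis by (simp add: nbr_count_def)
qed

section \<open>Chains of optimal sets in the square\<close>

text \<open>The vertices are numbered along nested solutions, which is \<open>opt\<close>.
  \<open>deg1\<close> and \<open>deg2\<close> are what density provides: \<delta>(2) \<ge> 1, and
  \<delta>(m) \<ge> 2 for m \<ge> 3. The sets \<open>A m\<close> are an arbitrary chain of optimal
  sets of the square.\<close>

locale square_chain =
  fixes R :: "nat \<Rightarrow> nat \<Rightarrow> bool" and n :: nat and A :: "nat \<Rightarrow> (nat \<times> nat) set"
  assumes sym: "symp R" and irr: "irreflp R"
    and opt: "\<And>B. B \<subseteq> {..<n} \<Longrightarrow> arc_count R B \<le> arc_count R {..<card B}"
    and deg1: "1 < n \<Longrightarrow> 1 \<le> nbr_count R {..<1} 1"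
    and deg2: "\<And>i. 2 \<le> i \<Longrightarrow> i < n \<Longrightarrow> 2 \<le> nbr_count R {..<i} i"
    and A_subset: "\<And>m. m \<le> n * n \<Longrightarrow> A m \<subseteq> {..<n} \<times> {..<n}"
    and card_A: "\<And>m. m \<le> n * n \<Longrightarrow> card (A m) = m"
    and A_Suc: "\<And>m. m < n * n \<Longrightarrow> A m \<subseteq> A (Suc m)"
    and best: "\<And>m B. m \<le> n * n \<Longrightarrow> B \<subseteq> {..<n} \<times> {..<n} \<Longrightarrow> card B = m \<Longrightarrow>
      arc_count (box R R) B \<le> arc_count (box R R) (A m)"
begin

abbreviation "V \<equiv> {..<n}"
abbreviation "E \<equiv> box R R"

text \<open>For \<open>i \<le> n\<close>, \<open>g i\<close> is twice the maximal number of edges on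
  \<open>i\<close> vertices. For \<open>i < n\<close>, \<open>b i\<close> below is \<delta>(i + 1),
  shifted because the vertices are numbered from 0.\<close>

definition g where "g i = arc_count R {..<i}"
definition b where "b i = nbr_count R {..<i} i"

text \<open>The value of the lexicographic initial segment of size \<open>t * n + i\<close>.\<close>
definition F where "F t i = n * g t + t * g n + 2 * b t * i + g i"

lemma symE: "symp E" and irrE: "irreflp E" using sym irr by (auto intro: symp_box irreflp_box)

lemma g_0: "g 0 = 0" by (simp add: g_def arc_count_def)

lemma g_Suc: "g (Suc i) = g i + 2 * b i"
  unfolding g_def b_def lessThan_Suc using sym irr by (intro arc_count_insert) auto

lemma F_Suc: "F t (Suc i) = F t i + 2 * (b t + b i)"
  by (simp add: F_def g_Suc)

text \<open>Full rows \<open>T \<times> V\<close> and a set \<open>B\<close> in the other rows: a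
  vertex of \<open>B\<close> sees the full rows only through its column, whatever its second
  coordinate is.\<close>

lemma arc_count_block_Un:
  assumes "T \<subseteq> V" "B \<subseteq> (V - T) \<times> V"
  shows "arc_count E (T \<times> V \<union> B) =
    n * arc_count R T + card T * g n + arc_count E B + 2 * (\<Sum>p\<in>B. nbr_count R T (fst p))"
proof -
  have "B \<subseteq> V \<times> V" using assms by auto
  then have fin: "finite T" "finite B"
    using assms(1) by (meson finite_SigmaI finite_lessThan finite_subset)+
  have "(\<Sum>p\<in>B. nbr_count E (T \<times> V) p) = (\<Sum>p\<in>B. nbr_count R T (fst p))"
    using assms by (intro sum.cong) (auto simp: nbr_count_Times)
  moreover have "T \<times> V \<inter> B = {}" using assms by auto
  ultimately show ?thesis using fin symE irr
    by (simp add: arc_count_Un arc_count_Times g_def)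
qed

definition lex_set where "lex_set t i = {..<t} \<times> V \<union> {t} \<times> {..<i}"

lemma lex_set:
  assumes "t < n" "i \<le> n"
  shows "lex_set t i \<subseteq> V \<times> V" "card (lex_set t i) = t * n + i" "arc_count E (lex_set t i) = F t i"
    "initial (V \<times> V) (lex_set t i)"
proof -
  show "lex_set t i \<subseteq> V \<times> V" using assms by (auto simp: lex_set_def)
  show "card (lex_set t i) = t * n + i"
    unfolding lex_set_def by (subst card_Un_disjoint) (auto simp: card_cartesian_product)
  have "(\<Sum>p\<in>{t} \<times> {..<i}. nbr_count R {..<t} (fst p)) = (\<Sum>p\<in>{t} \<times> {..<i}. b t)"
    by (intro sum.cong) (auto simp: b_def)
  also have "\<dots> = b t * i" by (simp add: card_cartesian_product)
  finally show "arc_count E (lex_set t i) = F t i"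
    unfolding lex_set_def using assms irr
    by (subst arc_count_block_Un) (auto simp: arc_count_row F_def g_def)
  show "initial (V \<times> V) (lex_set t i)" using assms by (auto simp: initial_def lex_set_def)
qed

lemma next_vertex:
  assumes "m < n * n"
  obtains v where "v \<in> V \<times> V" "v \<notin> A m" "A (Suc m) = insert v (A m)"
proof -
  have fin: "finite (A m)" using A_subset[of m] assms finite_subset by fastforce
  have "card (A (Suc m) - A m) = 1"
    using A_Suc[OF assms] card_A[of m] card_A[of "Suc m"] assms fin by (simp add: card_Diff_subset)
  then obtain v where v: "A (Suc m) - A m = {v}" by (rule card_1_singletonE)
  have "v \<in> V \<times> V" using v A_subset[of "Suc m"] assms by fastforce
  moreover have "A (Suc m) = insert v (A m)" using v A_Suc[OF assms] by auto
  ultimately show thesis using v that by blast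
qed

text \<open>Each new vertex must contribute at least as much as in the lexicographic order. Once two
  vertices have been added to \<open>T \<times> V\<close>, this is at least \<open>b t + 2\<close>, while a vertex off the line (row or
  column) spanned by them contributes at most \<open>b t + 1\<close>; so the whole line gets filled. A column
  has fewer than \<open>n\<close> free vertices as soon as \<open>T\<close> is nonempty, so the line is a row.\<close>

lemma row_step:
  assumes row: "1 < n \<Longrightarrow> \<forall>p\<in>A 2. \<forall>q\<in>A 2. fst p = fst q"
    and t: "t < n" and T: "T \<subseteq> V" "card T = t" "A (t * n) = T \<times> V"
  obtains y where "y \<in> V - T"
    "\<And>i. i \<le> n \<Longrightarrow> arc_count E (A (t * n + i)) \<le> F t i"
    "A (Suc t * n) = insert y T \<times> V"
proof -
  have finT: "finite T" using T finite_subset by auto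
  have size: "t * n + i \<le> n * n" if "i \<le> n" for i
  proof -
    have "Suc t * n \<le> n * n" using t by (intro mult_le_mono1) simp
    then show ?thesis using that by simp
  qed
  have size': "t * n + i < n * n" if "i < n" for i using size[of "Suc i"] that by simp
  have lower: "F t i \<le> arc_count E (A (t * n + i))" if "i \<le> n" for i
    using best[OF size[OF that], of "lex_set t i"] lex_set[OF t that] by simp
  \<comment> \<open>Comparison with the lexicographic segment of size \<open>t * n\<close> shows
    that \<open>T\<close> is optimal in the graph itself. Hence, in \<open>N\<close>, no further
    vertex has more than \<open>b t\<close> neighbours in \<open>T\<close>.\<close>
  have gT: "arc_count R T = g t"
  proof (rule antisym)
    show "arc_count R T \<le> g t" using opt[OF T(1)] T(2) by (simp add: g_def)
    have "arc_count E (A (t * n)) = n * arc_count R T + t * g n"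
      using arc_count_Times[of T V R R] finT irr T by (simp add: g_def)
    then have "n * g t \<le> n * arc_count R T" using lower[of 0] by (simp add: F_def g_0)
    then show "g t \<le> arc_count R T" using t by simp
  qed
  have N: "nbr_count R T y \<le> b t" if "y \<in> V - T" for y
  proof -
    have "arc_count R (insert y T) \<le> g (Suc t)"
      using opt[of "insert y T"] T finT that by (simp add: g_def)
    then show ?thesis using finT that sym irr by (simp add: arc_count_insert gT g_Suc)
  qed
  have upper: "arc_count E (T \<times> V \<union> B) \<le> F t i"
    if B: "B \<subseteq> (V - T) \<times> V" "card B = i" "arc_count E B \<le> g i" for B i
  proof -
    have "(\<Sum>p\<in>B. nbr_count R T (fst p)) \<le> card B * b t"
      using B N sum_bounded_above[of B "\<lambda>p. nbr_count R T (fst p)" "b t"] by fastforce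
    then show ?thesis
      using arc_count_block_Un[OF T(1) B(1)] B T gT by (simp add: F_def mult.commute)
  qed
  \<comment> \<open>The value at size \<open>t * n + i\<close> is at most \<open>F t i\<close>, and
    at the next size it is at least \<open>F t (Suc i)\<close>. By \<open>F_Suc\<close> the new
    vertex therefore has at least \<open>b t + b i\<close> neighbours.\<close>
  have gain: "\<exists>y z. y \<in> V - T \<and> z \<in> V \<and> (y, z) \<notin> B \<and>
      A (t * n + Suc i) = T \<times> V \<union> insert (y, z) B \<and>
      b t + b i \<le> nbr_count R T y + nbr_count E B (y, z)"
    if i: "i < n" and AB: "A (t * n + i) = T \<times> V \<union> B"
      and B: "B \<subseteq> (V - T) \<times> V" "card B = i" "arc_count E B \<le> g i" for B i
  proof -
    obtain v where v: "v \<in> V \<times> V" "v \<notin> A (t * n + i)"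
      "A (Suc (t * n + i)) = insert v (A (t * n + i))"
      using next_vertex[OF size'[OF i]] by blast
    obtain y z where yz: "v = (y, z)" by (cases v)
    have 1: "y \<in> V - T" "z \<in> V" "(y, z) \<notin> B" using v AB by (auto simp: yz)
    have finB: "finite B" using B(1) finite_subset[of B "V \<times> V"] by auto
    have "F t i + 2 * (b t + b i) \<le> arc_count E (A (t * n + Suc i))"
      using lower[of "Suc i"] i by (simp add: F_Suc)
    also have "A (t * n + Suc i) = insert (y, z) (T \<times> V \<union> B)" using v AB yz by simp
    also have "arc_count E \<dots> = arc_count E (T \<times> V \<union> B) + 2 * nbr_count E (T \<times> V \<union> B) (y, z)"
      using v AB yz finT finB symE irrE by (intro arc_count_insert) auto
    also have "nbr_count E (T \<times> V \<union> B) (y, z) = nbr_count R T y + nbr_count E B (y, z)"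
    proof -
      have "T \<times> V \<inter> B = {}" using B(1) by auto
      then show ?thesis using finT finB 1 by (simp add: nbr_count_Un nbr_count_Times)
    qed
    finally have "b t + b i \<le> nbr_count R T y + nbr_count E B (y, z)"
      using upper[OF B] by simp
    moreover have "A (t * n + Suc i) = T \<times> V \<union> insert (y, z) B" using v AB yz by simp
    ultimately show ?thesis using 1 by blast
  qed
  have rowB: "card ({y} \<times> C) = i" "arc_count E ({y} \<times> C) \<le> g i" if "C \<subseteq> V" "card C = i" for C y i
    using that opt[of C] irr by (auto simp: card_cartesian_product arc_count_row g_def)
  have colB: "card (C \<times> {z}) = i" "arc_count E (C \<times> {z}) \<le> g i" if "C \<subseteq> V" "card C = i" for C z i
    using that opt[of C] irr by (auto simp: card_cartesian_product arc_count_column g_def)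
  have "\<exists>y z. y \<in> V - T \<and> z \<in> V \<and> (y, z) \<notin> {} \<and>
      A (t * n + Suc 0) = T \<times> V \<union> insert (y, z) {} \<and>
      b t + b 0 \<le> nbr_count R T y + nbr_count E {} (y, z)"
    using t T(3) by (intro gain) (auto simp: arc_count_def)
  then obtain y z where yz: "y \<in> V - T" "z \<in> V" "A (t * n + 1) = T \<times> V \<union> {(y, z)}"
    by auto
  have rows: "\<exists>C\<subseteq>V. card C = i \<and> A (t * n + i) = T \<times> V \<union> {y} \<times> C" if "i \<le> n" for i
  proof (cases "i < 2")
    case True
    then consider "i = 0" | "i = 1" by linarith
    then show ?thesis
    proof cases
      case 1 then show ?thesis using T(3) by (intro exI[of _ "{}"]) auto
    next
      case 2 then show ?thesis using yz by (intro exI[of _ "{z}"]) auto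
    qed
  next
    case False
    then have n2: "1 < n" and "2 \<le> i" using that by auto
    have "\<exists>y' z'. y' \<in> V - T \<and> z' \<in> V \<and> (y', z') \<notin> {(y, z)} \<and>
        A (t * n + Suc 1) = T \<times> V \<union> insert (y', z') {(y, z)} \<and>
        b t + b 1 \<le> nbr_count R T y' + nbr_count E {(y, z)} (y', z')"
      using n2 yz rowB[of "{z}" 1 y] by (intro gain) auto
    then obtain y' z' where yz': "y' \<in> V - T" "z' \<in> V" "(y', z') \<noteq> (y, z)"
      "A (t * n + 2) = T \<times> V \<union> {(y', z'), (y, z)}"
      "b t + b 1 \<le> nbr_count R T y' + nbr_count E {(y, z)} (y', z')"
      by (auto simp: numeral_2_eq_2)
    \<comment> \<open>The second vertex has at most \<open>b t\<close> neighbours in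
      \<open>T \<times> V\<close> but needs \<open>b t + b 1\<close> in all, so it is adjacent to
      the first one.\<close>
    have "1 \<le> b 1" using deg1 n2 by (simp add: b_def)
    then have "0 < nbr_count E {(y, z)} (y', z')" using yz'(5) N[OF yz'(1)] by linarith
    then have adj: "y' = y \<or> z' = z" by (auto simp: nbr_count_def card_gt_0_iff)
    have "y' = y"
    proof (rule ccontr)
      assume ne: "y' \<noteq> y"
      then have z': "z' = z" using adj by simp
      show False
      \<comment> \<open>For \<open>t = 0\<close> the hypothesis \<open>row\<close> excludes a
        column. For \<open>t > 0\<close> the column would have to be filled with \<open>n\<close>
        vertices outside \<open>T\<close>, where only \<open>n - t\<close> are free.\<close>
      proof (cases "t = 0")
        case True
        then have "A 2 = {(y', z'), (y, z)}" using yz'(4) T(2) finT by (simp add: numeral_2_eq_2)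
        then have "fst (y', z') = fst (y, z)" using row[OF n2] by blast
        then show False using ne by simp
      next
        case t0: False
        have "\<exists>C\<subseteq>V - T. card C = j \<and> A (t * n + j) = T \<times> V \<union> C \<times> {z}"
          if "2 \<le> j" "j \<le> n" for j
          using that
        proof (induction j rule: dec_induct)
          case base
          show ?case using yz yz' z' ne by (intro exI[of _ "{y', y}"]) auto
        next
          case (step j)
          then obtain C where C: "C \<subseteq> V - T" "card C = j" "A (t * n + j) = T \<times> V \<union> C \<times> {z}"
            by auto
          have CV: "C \<subseteq> V" using C by auto
          have "\<exists>y' z'. y' \<in> V - T \<and> z' \<in> V \<and> (y', z') \<notin> C \<times> {z} \<and>
              A (t * n + Suc j) = T \<times> V \<union> insert (y', z') (C \<times> {z}) \<and>
              b t + b j \<le> nbr_count R T y' + nbr_count E (C \<times> {z}) (y', z')"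
            using step C yz colB[OF CV C(2)] by (intro gain) auto
          then obtain u w where uw: "u \<in> V - T" "w \<in> V" "(u, w) \<notin> C \<times> {z}"
            "A (t * n + Suc j) = T \<times> V \<union> insert (u, w) (C \<times> {z})"
            "b t + b j \<le> nbr_count R T u + nbr_count E (C \<times> {z}) (u, w)" by blast
          have "w = z"
          proof (rule ccontr)
            assume "w \<noteq> z"
            from nbr_count_column_le_1[OF this, of R R C u] N[OF uw(1)] uw(5)
              deg2[of j] step show False by (simp add: b_def)
          qed
          moreover have "finite C" using CV finite_subset by auto
          ultimately show ?case using uw C by (intro exI[of _ "insert u C"]) auto
        qed
        from this[of n] obtain C where "C \<subseteq> V - T" "card C = n" using n2 by auto
        then have "n \<le> card (V - T)" by (metis card_mono finite_Diff finite_lessThan)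
        then show False using T finT t0 t by (simp add: card_Diff_subset)
      qed
    qed
    from \<open>2 \<le> i\<close> \<open>i \<le> n\<close> show ?thesis
    proof (induction i rule: dec_induct)
      case base
      show ?case using yz yz' \<open>y' = y\<close> by (intro exI[of _ "{z', z}"]) auto
    next
      case (step j)
      then obtain C where C: "C \<subseteq> V" "card C = j" "A (t * n + j) = T \<times> V \<union> {y} \<times> C"
        by auto
      have "\<exists>y' z'. y' \<in> V - T \<and> z' \<in> V \<and> (y', z') \<notin> {y} \<times> C \<and>
          A (t * n + Suc j) = T \<times> V \<union> insert (y', z') ({y} \<times> C) \<and>
          b t + b j \<le> nbr_count R T y' + nbr_count E ({y} \<times> C) (y', z')"
        using step C yz rowB[OF C(1,2)] by (intro gain) auto
      then obtain u w where uw: "u \<in> V - T" "w \<in> V" "(u, w) \<notin> {y} \<times> C"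
        "A (t * n + Suc j) = T \<times> V \<union> insert (u, w) ({y} \<times> C)"
        "b t + b j \<le> nbr_count R T u + nbr_count E ({y} \<times> C) (u, w)" by blast
      have "u = y"
      proof (rule ccontr)
        assume "u \<noteq> y"
        from nbr_count_row_le_1[OF this, of R R C w] N[OF uw(1)] uw(5)
          deg2[of j] step show False by (simp add: b_def)
      qed
      moreover have "finite C" using C finite_subset by auto
      ultimately show ?case using uw C by (intro exI[of _ "insert w C"]) auto
    qed
  qed
  have "arc_count E (A (t * n + i)) \<le> F t i" if "i \<le> n" for i
  proof -
    obtain C where C: "C \<subseteq> V" "card C = i" "A (t * n + i) = T \<times> V \<union> {y} \<times> C"
      using rows[OF \<open>i \<le> n\<close>] by blast
    show ?thesis unfolding C(3) using C yz rowB[OF C(1,2)] by (intro upper) auto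
  qed
  moreover have "A (Suc t * n) = insert y T \<times> V"
  proof -
    obtain C where C: "C \<subseteq> V" "card C = n" "A (t * n + n) = T \<times> V \<union> {y} \<times> C"
      using rows[of n] by blast
    then have "C = V" by (intro card_subset_eq) auto
    then show ?thesis using C(3) by (auto simp: add.commute)
  qed
  ultimately show thesis using that yz(1) by blast
qed

text \<open>\<open>row_step\<close> is iterated from the empty set: at size \<open>t * n\<close> the
  chain occupies \<open>t\<close> complete rows, not necessarily the first ones. With
  \<open>best\<close>, the bound makes the lexicographic segments optimal.\<close>

lemma arc_count_le_F:
  assumes row: "1 < n \<Longrightarrow> \<forall>p\<in>A 2. \<forall>q\<in>A 2. fst p = fst q" and "t < n" "i \<le> n"
  shows "arc_count E (A (t * n + i)) \<le> F t i"
proof -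
  have blocks: "\<exists>T\<subseteq>V. card T = t \<and> A (t * n) = T \<times> V" if "t \<le> n" for t
    using that
  proof (induction t)
    case 0
    have "A 0 = {}" using card_A[of 0] A_subset[of 0] finite_subset[of "A 0" "V \<times> V"] by auto
    then show ?case by auto
  next
    case (Suc t)
    then obtain T where T: "T \<subseteq> V" "card T = t" "A (t * n) = T \<times> V" by auto
    have "t < n" using Suc by simp
    obtain y where "y \<in> V - T" "A (Suc t * n) = insert y T \<times> V"
      by (rule row_step[OF row \<open>t < n\<close> T])
    moreover have "finite T" using T finite_subset by auto
    ultimately show ?case using T by (intro exI[of _ "insert y T"]) auto
  qed
  then obtain T where T: "T \<subseteq> V" "card T = t" "A (t * n) = T \<times> V"
    using \<open>t < n\<close> by (meson less_imp_le)
  show ?thesis by (rule row_step[OF row \<open>t < n\<close> T]) (use \<open>i \<le> n\<close> in simp_all)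
qed

lemma initial_optimal_of_row:
  assumes row: "1 < n \<Longrightarrow> \<forall>p\<in>A 2. \<forall>q\<in>A 2. fst p = fst q"
  shows "initial_optimal E (V \<times> V)"
  unfolding initial_optimal_def
proof (intro allI impI)
  fix I B assume I: "initial (V \<times> V) I" and B: "B \<subseteq> V \<times> V" "card B = card I"
  have fin: "finite (V \<times> V)" by simp
  have m: "card I \<le> n * n"
    using card_mono[OF fin initial_subset[OF I]] by (simp add: card_cartesian_product)
  \<comment> \<open>Division by \<open>n\<close> yields \<open>t\<close> and \<open>i\<close>,
    except at full size, where it would give \<open>t = n\<close>; there the last row is taken as
    \<open>i = n\<close>.\<close>
  have "\<exists>t i. t < n \<and> i \<le> n \<and> card I = t * n + i" if "0 < n"
  proof (cases "card I = n * n")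
    case True
    have "n * n = (n - 1) * n + n" using that by (cases n) auto
    then show ?thesis using True that by (intro exI[of _ "n - 1"] exI[of _ n]) auto
  next
    case False
    then have "card I div n < n" using m that by (simp add: less_mult_imp_div_less)
    then show ?thesis using that
      by (intro exI[of _ "card I div n"] exI[of _ "card I mod n"]) (auto intro: less_imp_le)
  qed
  moreover have "B = {} \<and> I = {}" if "n = 0" using that I B initial_subset by auto
  ultimately consider "B = I" | t i where "t < n" "i \<le> n" "card I = t * n + i" by auto
  then show "arc_count E B \<le> arc_count E I"
  proof cases
    case 1 then show ?thesis by simp
  next
    case 2
    note L = lex_set[OF 2(1,2)]
    have "lex_set t i = I"
      using initial_card_le[OF fin L(4) I] initial_card_le[OF fin I L(4)] L(2) 2(3) by auto
    moreover have "arc_count E B \<le> arc_count E (A (t * n + i))" using best m B 2 by simp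
    ultimately show ?thesis using arc_count_le_F[OF row 2(1,2)] L(3) by simp
  qed
qed

text \<open>For \<open>n > 1\<close> an optimal pair of vertices is an edge, by \<open>deg1\<close>,
  and so lies in a row or in a column. In the latter case, swapping the coordinates, an automorphism
  of the square, yields a chain that starts in a row.\<close>

lemma initial_optimal_square: "initial_optimal E (V \<times> V)"
proof (cases "1 < n \<longrightarrow> (\<forall>p\<in>A 2. \<forall>q\<in>A 2. fst p = fst q)")
  case True
  then show ?thesis by (intro initial_optimal_of_row) blast
next
  case False
  then have n: "1 < n" by simp
  have "2 * 1 \<le> n * n" using n by (intro mult_le_mono) auto
  then have nn: "2 \<le> n * n" by simp
  have "arc_count E (lex_set 0 2) \<le> arc_count E (A 2)"
    using lex_set[of 0 2] n nn by (intro best) auto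
  moreover have "arc_count E (lex_set 0 2) \<ge> 2"
    using lex_set[of 0 2] n deg1 by (simp add: F_def g_0 numeral_2_eq_2 g_Suc b_def)
  ultimately have "{(p, q). p \<in> A 2 \<and> q \<in> A 2 \<and> E p q} \<noteq> {}"
    unfolding arc_count_def by fastforce
  then obtain p q where pq: "p \<in> A 2" "q \<in> A 2" "E p q" by blast
  have "p \<noteq> q" using pq(3) irreflpD[OF irrE] by metis
  have "A 2 = {p, q}"
    using card_A[OF nn] pq(1,2) \<open>p \<noteq> q\<close> by (auto simp: card_2_iff)
  with False have "fst p \<noteq> fst q" by auto
  then have "snd p = snd q" using pq(3) by (auto simp: box_def)
  interpret swapped: square_chain R n "\<lambda>m. prod.swap ` A m"
  proof (unfold_locales; (intro sym irr opt deg1 deg2)?)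
    fix m assume m: "m \<le> n * n"
    show "prod.swap ` A m \<subseteq> V \<times> V" using A_subset[OF m] by auto
    show "card (prod.swap ` A m) = m" using card_A[OF m] by (simp add: card_image)
    fix B assume B: "B \<subseteq> V \<times> V" "card B = m"
    have swap: "arc_count E (prod.swap ` C) = arc_count E C" for C
      by (intro arc_count_image) (auto simp: box_def)
    have "arc_count E (prod.swap ` B) \<le> arc_count E (A m)"
      using B by (intro best[OF m]) (auto simp: card_image)
    then show "arc_count E B \<le> arc_count E (prod.swap ` A m)" by (simp add: swap)
  next
    fix m assume "m < n * n"
    then show "prod.swap ` A m \<subseteq> prod.swap ` A (Suc m)" using A_Suc by blast
  qed auto
  show ?thesis
    using \<open>snd p = snd q\<close> \<open>A 2 = {p, q}\<close> by (intro swapped.initial_optimal_of_row) auto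
qed

end

section \<open>Transport of optimality along order isomorphisms\<close>

text \<open>A strictly increasing bijection maps initial segments to initial segments, and
  preserving adjacency it preserves arc counts.\<close>

lemma initial_optimal_vimage:
  fixes V :: "'a::linorder set" and W :: "'b::linorder set"
  assumes opt: "initial_optimal S W" and bij: "bij_betw f V W" and mono: "strict_mono_on V f"
    and adj: "\<And>x y. x \<in> V \<Longrightarrow> y \<in> V \<Longrightarrow> S (f x) (f y) \<longleftrightarrow> R x y"
  shows "initial_optimal R V"
  unfolding initial_optimal_def
proof (intro allI impI)
  fix I A assume I: "initial V I" and A: "A \<subseteq> V" "card A = card I"
  have inj: "inj_on f V" and im: "f ` V = W" using bij by (auto simp: bij_betw_def)
  have IV: "I \<subseteq> V" using I by (rule initial_subset)
  have injs: "inj_on f I" "inj_on f A" using inj IV A inj_on_subset by blast+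
  have "initial W (f ` I)"
    unfolding initial_def
  proof (intro conjI ballI impI)
    fix x y assume "x \<in> f ` I" "y \<in> W" "y < x"
    then obtain u v where uv: "u \<in> I" "x = f u" "v \<in> V" "y = f v" using im by blast
    have "v < u"
      using \<open>y < x\<close> uv IV mono by (metis less_asym linorder_neqE strict_mono_onD subsetD)
    then show "y \<in> f ` I" using I uv initialD by blast
  qed (use im IV in auto)
  moreover have "f ` A \<subseteq> W" using A im by auto
  ultimately have "arc_count S (f ` A) \<le> arc_count S (f ` I)"
    using opt A(2) injs by (intro initial_optimalD[OF opt]) (auto simp: card_image)
  moreover have "arc_count S (f ` A) = arc_count R A"
    using injs A adj by (intro arc_count_image) auto
  moreover have "arc_count S (f ` I) = arc_count R I"
    using injs IV adj by (intro arc_count_image) auto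
  ultimately show "arc_count R A \<le> arc_count R I" by simp
qed

lemma initial_optimal_image:
  fixes V :: "'a::linorder set" and W :: "'b::linorder set"
  assumes opt: "initial_optimal R V" and bij: "bij_betw f V W" and mono: "strict_mono_on V f"
    and adj: "\<And>x y. x \<in> V \<Longrightarrow> y \<in> V \<Longrightarrow> S (f x) (f y) \<longleftrightarrow> R x y"
  shows "initial_optimal S W"
proof (rule initial_optimal_vimage[OF opt])
  let ?g = "inv_into V f"
  have g: "?g w \<in> V" "f (?g w) = w" if "w \<in> W" for w
    using bij that by (auto simp: bij_betw_def inv_into_into f_inv_into_f)
  show "bij_betw ?g W V" using bij by (rule bij_betw_inv_into)
  show "strict_mono_on W ?g"
  proof (rule strict_mono_onI)
    fix r s assume rs: "r \<in> W" "s \<in> W" "r < s"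
    then show "?g r < ?g s"
      using g[OF rs(1)] g[OF rs(2)] mono by (metis less_asym linorder_neqE strict_mono_onD)
  qed
  show "R (?g x) (?g y) \<longleftrightarrow> S x y" if "x \<in> W" "y \<in> W" for x y
    using g[OF that(1)] g[OF that(2)] adj by metis
qed

subsection \<open>Powers\<close>

text \<open>Adjacency in all powers at once: the words agree apart from one place, where the letters
  are related by \<open>R\<close>. Words of different lengths are never adjacent.\<close>

fun list_adj :: "('a \<Rightarrow> 'a \<Rightarrow> bool) \<Rightarrow> 'a list \<Rightarrow> 'a list \<Rightarrow> bool" where
  "list_adj R (x # xs) (y # ys) \<longleftrightarrow> x = y \<and> list_adj R xs ys \<or> R x y \<and> xs = ys"
| "list_adj R _ _ \<longleftrightarrow> False"

definition words :: "'a set \<Rightarrow> nat \<Rightarrow> 'a list set" where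
  "words V d = {xs. length xs = d \<and> set xs \<subseteq> V}"

lemma finite_words: "finite V \<Longrightarrow> finite (words V d)"
  using finite_lists_length_eq[of V d] by (simp add: words_def conj_commute)

lemma list_adj_symD: "symp R \<Longrightarrow> list_adj R xs ys \<Longrightarrow> list_adj R ys xs"
  by (induction R xs ys rule: list_adj.induct) (auto dest: sympD)

lemma symp_list_adj: "symp R \<Longrightarrow> symp (list_adj R)"
  using list_adj_symD by (metis sympI)

lemma irreflp_list_adj: "irreflp R \<Longrightarrow> irreflp (list_adj R)"
proof (rule irreflpI)
  fix xs assume "irreflp R"
  then show "\<not> list_adj R xs xs" by (induction xs) (auto dest: irreflpD)
qed

text \<open>The recursion of \<open>list_adj\<close> read from the other end; words are going to be
  split at both ends.\<close>

lemma list_adj_snoc: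
  "length xs = length ys \<Longrightarrow>
    list_adj R (xs @ [x]) (ys @ [y]) \<longleftrightarrow> xs = ys \<and> R x y \<or> list_adj R xs ys \<and> x = y"
  by (induction xs ys rule: list_induct2) auto

lemma list_adj_map:
  assumes "\<And>x y. x \<in> V \<Longrightarrow> y \<in> V \<Longrightarrow> S (f x) (f y) \<longleftrightarrow> R x y" and "inj_on f V"
    and "length xs = length ys" "set xs \<subseteq> V" "set ys \<subseteq> V"
  shows "list_adj S (map f xs) (map f ys) \<longleftrightarrow> list_adj R xs ys"
  using assms(3-5)
proof (induction xs ys rule: list_induct2)
  case (Cons x xs y ys)
  have "map f xs = map f ys \<longleftrightarrow> xs = ys"
    using Cons.prems \<open>inj_on f V\<close> by (intro inj_on_map_eq_map) (auto intro: inj_on_subset)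
  moreover have "f x = f y \<longleftrightarrow> x = y" using Cons.prems \<open>inj_on f V\<close> by (auto dest: inj_onD)
  ultimately show ?case using Cons assms(1)[of x y] by simp
qed simp

lemma snoc_less:
  fixes x y :: "'a::linorder"
  shows "length xs = length ys \<Longrightarrow> xs @ [x] < ys @ [y] \<longleftrightarrow> xs < ys \<or> xs = ys \<and> x < y"
  by (induction xs ys rule: list_induct2) auto

lemma bij_betw_words_Cons:
  "bij_betw (\<lambda>(x, xs). x # xs) (V \<times> words V d) (words V (Suc d))"
  by (auto simp: bij_betw_def inj_on_def words_def image_iff length_Suc_conv)

lemma bij_betw_words_snoc:
  "bij_betw (\<lambda>(xs, x). xs @ [x]) (words V d \<times> V) (words V (Suc d))"
proof -
  have "\<exists>ys y. ys \<in> words V d \<and> y \<in> V \<and> xs = ys @ [y]" if "xs \<in> words V (Suc d)" for xs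
    using that by (cases xs rule: rev_cases) (auto simp: words_def)
  moreover have "ys @ [y] \<in> words V (Suc d)" if "ys \<in> words V d" "y \<in> V" for ys y
    using that by (auto simp: words_def)
  ultimately show ?thesis by (force simp: bij_betw_def inj_on_def image_iff)
qed

text \<open>A word of length at least 3 consists of a first letter, a middle word and a last letter.
  The middle word with either letter is a word shorter by one, to which the induction hypothesis
  applies; the two outer letters form \<open>V \<times> V\<close>, which is
  \<open>opt2\<close>.\<close>

lemma initial_optimal_words:
  fixes V :: "'a::linorder set"
  assumes fin: "finite V" and sym: "symp R" and irr: "irreflp R"
    and opt1: "initial_optimal R V" and opt2: "initial_optimal (box R R) (V \<times> V)"
  shows "initial_optimal (list_adj R) (words V (Suc d))"
proof (induction d rule: less_induct)
  case (less d)
  \<comment> \<open>The words have length \<open>Suc d\<close>, so the cases are length 1, length 2,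
    and length \<open>e + 3\<close> with a middle word of length \<open>e + 1\<close>.\<close>
  consider "d = 0" | "d = 1" | e where "d = Suc (Suc e)" by (metis One_nat_def not0_implies_Suc)
  then show ?case
  proof cases
    case 1
    have "bij_betw (\<lambda>x. [x]) V (words V (Suc 0))"
      by (auto simp: bij_betw_def inj_on_def words_def image_iff length_Suc_conv)
    then show ?thesis unfolding 1
      by (rule initial_optimal_image[OF opt1]) (auto intro!: strict_mono_onI)
  next
    case 2
    have "bij_betw (\<lambda>(x, y). [x, y]) (V \<times> V) (words V (Suc 1))"
      by (auto simp: bij_betw_def inj_on_def words_def image_iff length_Suc_conv)
    then show ?thesis unfolding 2
      by (rule initial_optimal_image[OF opt2]) (auto intro!: strict_mono_onI)
  next
    case (3 e)
    let ?W = "words V (Suc e)" and ?L = "list_adj R"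
    have opt: "initial_optimal ?L (words V (Suc (Suc e)))" using less 3 by simp
    have "initial_optimal (box R ?L) (V \<times> ?W)"
      by (rule initial_optimal_vimage[OF opt bij_betw_words_Cons])
        (auto intro!: strict_mono_onI)
    moreover have "initial_optimal (box ?L R) (?W \<times> V)"
      by (rule initial_optimal_vimage[OF opt bij_betw_words_snoc])
        (auto intro!: strict_mono_onI simp: list_adj_snoc snoc_less words_def)
    ultimately have opt3: "initial_optimal (box R (box ?L R)) (V \<times> ?W \<times> V)"
      using fin sym irr opt2
      by (intro initial_optimal_three_factors finite_words symp_list_adj irreflp_list_adj)
    have "bij_betw ((\<lambda>(x, xs). x # xs) \<circ> map_prod id (\<lambda>(xs, x). xs @ [x]))
        (V \<times> ?W \<times> V) (words V (Suc (Suc (Suc e))))"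
      by (intro bij_betw_trans[OF _ bij_betw_words_Cons] bij_betw_map_prod bij_betw_words_snoc)
        (simp add: bij_betw_def)
    then show ?thesis unfolding 3
      by (rule initial_optimal_image[OF opt3]) (auto intro!: strict_mono_onI simp: list_adj_snoc snoc_less words_def)
  qed
qed

subsection \<open>Graphs\<close>

definition adj :: "'a ugraph \<Rightarrow> 'a \<Rightarrow> 'a \<Rightarrow> bool" where
  "adj G x y \<longleftrightarrow> {x, y} \<in> edges G"

lemma symp_adj: "symp (adj G)"
  by (auto simp: symp_def adj_def insert_commute)

lemma irreflp_adj: "simple_graph G \<Longrightarrow> irreflp (adj G)"
  by (force simp: irreflp_def adj_def simple_graph_def)

lemma arc_count_adj:
  assumes "simple_graph G" "finite A"
  shows "arc_count (adj G) A = 2 * card (induced_edges G A)"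
proof -
  let ?P = "\<lambda>e. {(x, y). e = {x, y}}"
  have two: "card (?P e) = 2 \<and> finite (?P e)" if "e \<in> induced_edges G A" for e
  proof -
    have "card e = 2" using that assms(1) by (auto simp: induced_edges_def simple_graph_def)
    then obtain a b where ab: "e = {a, b}" "a \<noteq> b" by (auto simp: card_2_iff)
    then have "?P e = {(a, b), (b, a)}" by (auto simp: doubleton_eq_iff)
    then show ?thesis using ab by simp
  qed
  have "{(x, y). x \<in> A \<and> y \<in> A \<and> adj G x y} = (\<Union>e\<in>induced_edges G A. ?P e)"
    by (auto simp: induced_edges_def adj_def)
  moreover have "finite (induced_edges G A)"
    using assms(2) by (auto simp: induced_edges_def intro: finite_subset[of _ "Pow A"])
  moreover have "card (\<Union>e\<in>induced_edges G A. ?P e) = (\<Sum>e\<in>induced_edges G A. card (?P e))"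
    using two \<open>finite (induced_edges G A)\<close> by (intro card_UN_disjoint) auto
  ultimately show ?thesis using two by (simp add: arc_count_def)
qed

text \<open>\<open>max_induced\<close> is the maximum of a finite set of numbers to which
  \<open>A\<close> itself contributes, so attaining it means that no competitor is better. Arcs are
  twice the edges, which does not affect the comparison.\<close>

lemma optimal_iff:
  assumes "simple_graph G"
  shows "optimal G m A \<longleftrightarrow> A \<subseteq> verts G \<and> card A = m \<and>
    (\<forall>B. B \<subseteq> verts G \<longrightarrow> card B = m \<longrightarrow> arc_count (adj G) B \<le> arc_count (adj G) A)"
proof -
  let ?M = "{card (induced_edges G A) | A. A \<subseteq> verts G \<and> card A = m}"
  have fin: "finite (verts G)" using assms by (simp add: simple_graph_def)
  have "?M \<subseteq> (\<lambda>A. card (induced_edges G A)) ` Pow (verts G)" by auto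
  then have finM: "finite ?M" using fin by (meson finite_Pow_iff finite_imageI finite_subset)
  have arc: "arc_count (adj G) B = 2 * card (induced_edges G B)" if "B \<subseteq> verts G" for B
    using arc_count_adj[OF assms] that fin finite_subset by blast
  have "card (induced_edges G A) = Max ?M \<longleftrightarrow>
      (\<forall>B. B \<subseteq> verts G \<longrightarrow> card B = m \<longrightarrow> card (induced_edges G B) \<le> card (induced_edges G A))"
    if "A \<subseteq> verts G" "card A = m"
  proof
    assume "card (induced_edges G A) = Max ?M"
    then show "\<forall>B. B \<subseteq> verts G \<longrightarrow> card B = m \<longrightarrow>
        card (induced_edges G B) \<le> card (induced_edges G A)"
      using finM by (auto intro!: Max_ge)
  next
    assume "\<forall>B. B \<subseteq> verts G \<longrightarrow> card B = m \<longrightarrow>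
        card (induced_edges G B) \<le> card (induced_edges G A)"
    then show "card (induced_edges G A) = Max ?M"
      using finM that by (intro Max_eqI[symmetric]) auto
  qed
  then show ?thesis unfolding optimal_def max_induced_def using arc by auto
qed

text \<open>The chain is extended downwards by the empty set, so that sizes start at 0.\<close>

lemma nested_solutionsE:
  assumes "simple_graph G" "nested_solutions G"
  obtains A where "\<And>i. i \<le> card (verts G) \<Longrightarrow> optimal G i (A i)"
    "\<And>i. i < card (verts G) \<Longrightarrow> A i \<subseteq> A (Suc i)"
proof -
  obtain A where A: "\<And>i. i \<in> {1..card (verts G)} \<Longrightarrow> optimal G i (A i)"
    "\<And>i. i \<in> {1..<card (verts G)} \<Longrightarrow> A i \<subseteq> A (Suc i)"
    using assms(2) unfolding nested_solutions_def by blast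
  have "finite (verts G)" using assms(1) by (simp add: simple_graph_def)
  then have "B = {}" if "B \<subseteq> verts G" "card B = 0" for B
    using that finite_subset by fastforce
  then have "optimal G 0 {}" using assms(1) by (auto simp: optimal_iff)
  then show thesis
    using A that[of "\<lambda>i. if i = 0 then {} else A i"] by auto
qed

text \<open>\<open>f i\<close> is the vertex that \<open>A (Suc i)\<close> has in addition to
  \<open>A i\<close>. It is injective on \<open>{..<n}\<close> because the image has
  \<open>n\<close> elements.\<close>

lemma chain_enumeration:
  assumes "\<And>i. i \<le> n \<Longrightarrow> finite (A i) \<and> card (A i) = i" "\<And>i. i < n \<Longrightarrow> A i \<subseteq> A (Suc i)"
  obtains f where "\<And>i. i \<le> n \<Longrightarrow> A i = f ` {..<i}" "inj_on f {..<n}"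
proof -
  define f where "f i = (SOME x. A (Suc i) = insert x (A i))" for i
  have f: "A (Suc i) = insert (f i) (A i)" if "i < n" for i
  proof -
    have "card (A (Suc i) - A i) = 1"
      using assms(1)[of i] assms(1)[of "Suc i"] assms(2)[OF that] that
      by (simp add: card_Diff_subset)
    then obtain x where "A (Suc i) - A i = {x}" by (rule card_1_singletonE)
    then have "A (Suc i) = insert x (A i)" using assms(2)[OF that] by auto
    then show ?thesis unfolding f_def by (rule someI)
  qed
  have "A i = f ` {..<i}" if "i \<le> n" for i
    using that
  proof (induction i)
    case 0 then show ?case using assms(1)[of 0] by auto
  next
    case (Suc i) then show ?case using f[of i] by (simp add: lessThan_Suc)
  qed
  moreover then have "inj_on f {..<n}"
    using assms(1)[of n] by (intro eq_card_imp_inj_on) auto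
  ultimately show thesis using that by blast
qed

section \<open>Edges of the Cartesian powers\<close>

text \<open>An edge of the power is an unordered pair; the condition \<open>C\<close> is symmetric,
  so its two ends may be taken in the given order and compared letter by letter.\<close>

lemma edges_cart_power:
  "{xs, ys} \<in> edges (cart_power G d) \<longleftrightarrow>
    xs \<in> verts (cart_power G d) \<and> ys \<in> verts (cart_power G d) \<and> list_adj (adj G) xs ys"
proof (induction d arbitrary: xs ys)
  case (Suc d)
  let ?W = "verts (cart_power G d)"
  define C where "C x y u v \<longleftrightarrow> x \<in> verts G \<and> y \<in> ?W \<and> u \<in> verts G \<and> v \<in> ?W \<and>
      (x = u \<and> {y, v} \<in> edges (cart_power G d) \<or> adj G x u \<and> y = v)" for x y u v
  have C_sym: "C x y u v \<Longrightarrow> C u v x y" for x y u v by (auto simp: C_def adj_def insert_commute)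
  have "edges (cart_power G (Suc d)) =
      (\<lambda>e. (\<lambda>(x, xs). x # xs) ` e) ` {{(x, y), (u, v)} | x y u v. C x y u v}"
    by (simp add: relabel_def cart_prod_def C_def adj_def)
  also have "\<dots> = {(\<lambda>(x, xs). x # xs) ` {(x, y), (u, v)} | x y u v. C x y u v}"
    by blast
  finally have "{xs, ys} \<in> edges (cart_power G (Suc d)) \<longleftrightarrow>
      (\<exists>x y u v. {xs, ys} = {x # y, u # v} \<and> C x y u v)"
    by simp
  also have "\<dots> \<longleftrightarrow> (\<exists>x y u v. xs = x # y \<and> ys = u # v \<and> C x y u v)"
    unfolding doubleton_eq_iff using C_sym by blast
  also have "\<dots> \<longleftrightarrow> xs \<in> verts (cart_power G (Suc d)) \<and> ys \<in> verts (cart_power G (Suc d)) \<and>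
      list_adj (adj G) xs ys"
    by (cases xs; cases ys) (auto simp: C_def Suc.IH verts_cart_power simp del: cart_power.simps)
  finally show ?case .
qed simp

lemma simple_graph_cart_power:
  assumes "simple_graph G"
  shows "simple_graph (cart_power G d)"
proof -
  have irr: "irreflp (list_adj (adj G))"
    using assms by (intro irreflp_list_adj irreflp_adj)
  have "\<exists>xs ys. e = {xs, ys}" if "e \<in> edges (cart_power G d)" for e
    using that by (cases d) (auto simp: relabel_def cart_prod_def)
  then have "e \<subseteq> verts (cart_power G d) \<and> card e = 2" if "e \<in> edges (cart_power G d)" for e
  proof -
    obtain xs ys where e: "e = {xs, ys}" using \<open>\<And>e. e \<in> _ \<Longrightarrow> _\<close> \<open>e \<in> _\<close> by blast
    then have "xs \<noteq> ys" using that irreflpD[OF irr] by (auto simp: edges_cart_power)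
    then show ?thesis using that e by (auto simp: edges_cart_power)
  qed
  moreover have "finite (verts (cart_power G d))"
    using assms finite_words[of "verts G" d] by (simp add: verts_cart_power simple_graph_def words_def)
  ultimately show ?thesis by (simp add: simple_graph_def)
qed

section \<open>Density as a lower bound on \<delta>\<close>

text \<open>In the first segment the values are integers that increase strictly from \<delta>(1)
  \<ge> 0. In a later segment the first value is at least 2 and the others exceed it.\<close>

lemma delta_dense_ge:
  assumes "delta_dense G" "0 \<le> delta G 1" "2 \<le> m" "m \<le> card (verts G)"
  shows "1 \<le> delta G m \<and> (3 \<le> m \<longrightarrow> 2 \<le> delta G m)"
proof -
  let ?xs = "[1..<Suc (card (verts G))]" and ?rs = "segments G"
  have cat: "concat ?rs = ?xs" by (simp only: segments_def concat_increasing_runs)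
  have "m \<in> set (concat ?rs)" unfolding cat using assms by auto
  then obtain j where j: "j < length ?rs" "m \<in> set (?rs ! j)"
    by (metis (no_types, lifting) UN_E in_set_conv_nth set_concat)
  have sorted: "sorted_wrt (\<lambda>x y. delta G x < delta G y) (?rs ! j)" and ne: "?rs ! j \<noteq> []"
    using increasing_runs_strict[of "?rs ! j" "delta G" ?xs] j(1) by (auto simp: segments_def)
  \<comment> \<open>\<open>?p\<close> positions precede the list \<open>?rs ! j\<close>. As
    positions start at 1, its entries are the numbers \<open>1 + ?p + k\<close>.\<close>
  let ?p = "length (concat (take j ?rs))"
  have split: "?xs = concat (take j ?rs) @ ?rs ! j @ concat (drop (Suc j) ?rs)"
    unfolding cat[symmetric] by (subst id_take_nth_drop[OF j(1)]) simp
  have nth: "?rs ! j ! k = 1 + ?p + k" if "k < length (?rs ! j)" for k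
  proof -
    have "?rs ! j ! k = ?xs ! (?p + k)" unfolding split using that by (simp add: nth_append)
    moreover have "?p + k < length ?xs" unfolding split using that by simp
    ultimately show ?thesis by (simp del: upt_Suc)
  qed
  obtain k where k: "k < length (?rs ! j)" "m = ?rs ! j ! k" using j(2) by (auto simp: in_set_conv_nth)
  have inc: "delta G (1 + ?p + a) < delta G (1 + ?p + b)" if "a < b" "b < length (?rs ! j)" for a b
    using sorted_wrt_nth_less[OF sorted that] nth that by simp
  show ?thesis
  proof (cases "j = 0")
    case True
    then have inc': "delta G (1 + a) < delta G (1 + b)" if "a < b" "b < length (?rs ! j)" for a b
      using inc[OF that] by simp
    have m: "m = 1 + k" using nth k True by simp
    have "0 < k" using m assms by simp
    then have 1: "1 \<le> delta G m" using inc'[of 0 k] k assms m by simp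
    moreover have "2 \<le> delta G m" if "3 \<le> m"
    proof -
      have "1 < k" using that m by simp
      then show ?thesis using inc'[of 0 1] inc'[of 1 k] k assms m by simp
    qed
    ultimately show ?thesis by blast
  next
    case False
    have "distinct (concat ?rs)" unfolding cat by (rule distinct_upt)
    then have dist: "distinct (?rs ! l)" if "l < length ?rs" for l
      using that by (simp add: distinct_concat_iff)
    \<comment> \<open>Segments are numbered from 1 and list entries from 0, so
      \<open>?rs ! j\<close> is segment \<open>Suc j\<close>.\<close>
    have "(\<Sum>l=1..Suc j - 1. card (segment G l)) = (\<Sum>l<j. length (?rs ! l))"
      using j(1) dist
      by (intro sum.reindex_bij_witness[of _ Suc "\<lambda>l. l - 1"])
        (auto simp: segment_def distinct_card)
    also have "\<dots> = ?p"
      using j(1) by (simp add: length_concat sum_list_sum_nth atLeast0LessThan)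
    finally have "segment_start G (Suc j) = delta G (1 + ?p)" by (simp add: segment_start_def)
    moreover have "1 < segment_start G (Suc j)"
      using assms(1) j(1) False unfolding delta_dense_def num_segments_def by auto
    moreover have "delta G (1 + ?p) \<le> delta G m"
      using inc[of 0 k] k nth by (cases "k = 0") auto
    ultimately show ?thesis by simp
  qed
qed

theorem theorem4:
  fixes G :: "'a ugraph"
  assumes "simple_graph G"
    and "delta_dense G"
    and "nested_solutions G"
    and "nested_solutions (cart_power G 2)"
  shows "\<forall>d\<ge>3. nested_solutions (cart_power G d)"
proof (intro allI impI)
  fix d :: nat assume d: "3 \<le> d"
  define n where "n = card (verts G)"
  have finG: "finite (verts G)" using assms(1) by (simp add: simple_graph_def)
  obtain A where A: "\<And>i. i \<le> n \<Longrightarrow> optimal G i (A i)" "\<And>i. i < n \<Longrightarrow> A i \<subseteq> A (Suc i)"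
    using nested_solutionsE[OF assms(1,3)] unfolding n_def by blast
  have Af: "finite (A i) \<and> card (A i) = i" if "i \<le> n" for i
    using A(1)[OF that] finG finite_subset by (auto simp: optimal_def)
  obtain f where f: "\<And>i. i \<le> n \<Longrightarrow> A i = f ` {..<i}" and injf: "inj_on f {..<n}"
    using chain_enumeration[OF Af A(2)] by blast
  have "A n = verts G"
    using A(1)[of n] finG by (intro card_subset_eq) (auto simp: optimal_def n_def)
  then have imf: "f ` {..<n} = verts G" using f[of n] by simp
  \<comment> \<open>A copy of \<open>G\<close> on the numbers below \<open>n\<close>, in which the
    given nested solutions become the sets \<open>{..<i}\<close>.\<close>
  define R where "R i j \<longleftrightarrow> i < n \<and> j < n \<and> adj G (f i) (f j)" for i j
  have symR: "symp R" using symp_adj[of G] by (auto simp: R_def symp_def)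
  have irrR: "irreflp R" using irreflp_adj[OF assms(1)] by (auto simp: R_def irreflp_def)
  have arcR: "arc_count (adj G) (f ` B) = arc_count R B" if "B \<subseteq> {..<n}" for B
    using that injf by (intro arc_count_image) (auto simp: R_def intro: inj_on_subset)
  have opt: "arc_count R B \<le> arc_count R {..<card B}" if B: "B \<subseteq> {..<n}" for B
  proof -
    have c: "card B \<le> n" using card_mono[OF _ B] by simp
    have "f ` B \<subseteq> verts G" "card (f ` B) = card B"
      using B imf injf by (auto intro: card_image inj_on_subset)
    then have "arc_count (adj G) (f ` B) \<le> arc_count (adj G) (f ` {..<card B})"
      using A(1)[OF c] f[OF c] by (simp add: optimal_iff[OF assms(1)])
    then show ?thesis using arcR[OF B] arcR[of "{..<card B}"] c by simp
  qed
  have optR: "initial_optimal R {..<n}"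
    unfolding initial_optimal_def
  proof (intro allI impI)
    fix I B assume I: "initial {..<n} I" and B: "B \<subseteq> {..<n}" "card B = card I"
    have "card I \<le> n" using card_mono[OF _ initial_subset[OF I]] by simp
    then have "initial {..<n} {..<card I}" by (auto simp: initial_def)
    then have "{..<card I} = I"
      using initial_card_le[OF _ I] initial_card_le[OF _ _ I] by (simp add: antisym)
    then show "arc_count R B \<le> arc_count R I" using opt[OF B(1)] B(2) by simp
  qed
  have deg: "delta G (Suc i) = int (nbr_count R {..<i} i)" if "i < n" for i
  proof -
    have max: "2 * max_induced G k = arc_count R {..<k}" if "k \<le> n" for k
      using A(1)[OF that] arc_count_adj[OF assms(1), of "A k"] Af[OF that] arcR[of "{..<k}"] f[OF that] that
      by (simp add: optimal_def)
    have "arc_count R {..<Suc i} = arc_count R {..<i} + 2 * nbr_count R {..<i} i"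
      unfolding lessThan_Suc using symR irrR by (intro arc_count_insert) auto
    then show ?thesis using max[of i] max[of "Suc i"] that by (simp add: delta_def)
  qed
  \<comment> \<open>\<delta>(i + 1) is the number of neighbours of vertex \<open>i\<close> among the
    earlier ones; the instance \<open>deg[of 0]\<close> supplies \<delta>(1) \<ge> 0.\<close>
  have dense: "1 \<le> nbr_count R {..<i} i \<and> (2 \<le> i \<longrightarrow> 2 \<le> nbr_count R {..<i} i)"
    if "1 \<le> i" "i < n" for i
    using delta_dense_ge[OF assms(2), of "Suc i"] deg[of 0] deg[of i] that
    by (auto simp: n_def)

  have bij: "bij_betw (map f) (words {..<n} k) (verts (cart_power G k))" for k
  proof -
    have "map f ` words {..<n} k = words (verts G) k"
    proof (intro equalityI subsetI)
      fix xs assume "xs \<in> words (verts G) k"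
      then have "xs \<in> lists (f ` {..<n})" "length xs = k" by (auto simp: words_def imf)
      then obtain ys where "xs = map f ys" "ys \<in> lists {..<n}" by (auto simp: lists_image)
      then show "xs \<in> map f ` words {..<n} k" using \<open>length xs = k\<close> by (auto simp: words_def)
    next
      fix xs assume "xs \<in> map f ` words {..<n} k"
      then obtain ys where ys: "xs = map f ys" "length ys = k" "set ys \<subseteq> {..<n}"
        by (auto simp: words_def)
      then have "set xs \<subseteq> f ` {..<n}" by (simp add: image_mono)
      then show "xs \<in> words (verts G) k" using ys by (simp add: words_def imf)
    qed
    moreover have "inj_on (map f) (words {..<n} k)"
      by (intro inj_on_mapI inj_on_subset[OF injf]) (unfold words_def, blast)
    ultimately show ?thesis by (simp add: bij_betw_def verts_cart_power words_def)
  qed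
  have adjL: "adj (cart_power G k) (map f xs) (map f ys) \<longleftrightarrow> list_adj R xs ys"
    if "xs \<in> words {..<n} k" "ys \<in> words {..<n} k" for xs ys k
  proof -
    have "map f xs \<in> verts (cart_power G k)" "map f ys \<in> verts (cart_power G k)"
      using bij[of k] that by (auto simp: bij_betw_def)
    then have "adj (cart_power G k) (map f xs) (map f ys) \<longleftrightarrow>
        list_adj (adj G) (map f xs) (map f ys)" by (simp add: adj_def[of "cart_power G k"] edges_cart_power)
    also have "\<dots> \<longleftrightarrow> list_adj R xs ys"
      using that injf by (intro list_adj_map[of "{..<n}"]) (auto simp: R_def words_def)
    finally show ?thesis .
  qed
  have card_power: "card (verts (cart_power G k)) = n ^ k" for k
    using bij_betw_same_card[OF bij[of k]] card_lists_length_eq[of "{..<n}" k]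
    by (simp add: words_def conj_commute)

  let ?VV = "{..<n} \<times> {..<n}"
  \<comment> \<open>Identifies pairs of numbers with the vertices of \<open>cart_power G 2\<close>,
    which are lists of length two. The chain of the square is pulled back along it to serve as
    \<open>A\<close> in \<open>square_chain\<close>.\<close>
  define \<phi> where "\<phi> = (\<lambda>p. map f [fst p, snd p])"
  have bij2: "bij_betw \<phi> ?VV (verts (cart_power G 2))"
  proof -
    have "bij_betw (\<lambda>p. [fst p, snd p]) ?VV (words {..<n} 2)"
      by (auto simp: bij_betw_def inj_on_def words_def image_iff length_Suc_conv numeral_2_eq_2)
    from bij_betw_trans[OF this bij[of 2]] show ?thesis by (simp add: \<phi>_def comp_def)
  qed
  have arc2: "arc_count (adj (cart_power G 2)) (\<phi> ` B) = arc_count (box R R) B" if "B \<subseteq> ?VV" for B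
  proof (rule arc_count_image)
    show "inj_on \<phi> B" using bij2 that by (auto simp: bij_betw_def intro: inj_on_subset)
    fix p q assume "p \<in> B" "q \<in> B"
    then have "[fst p, snd p] \<in> words {..<n} 2" "[fst q, snd q] \<in> words {..<n} 2"
      using that by (auto simp: words_def)
    then show "adj (cart_power G 2) (\<phi> p) (\<phi> q) \<longleftrightarrow> box R R p q"
      unfolding \<phi>_def by (subst adjL) (auto simp: box_def)
  qed
  note simple2 = simple_graph_cart_power[OF assms(1), of 2]
  obtain C where C: "\<And>i. i \<le> n * n \<Longrightarrow> optimal (cart_power G 2) i (C i)"
    "\<And>i. i < n * n \<Longrightarrow> C i \<subseteq> C (Suc i)"
    using nested_solutionsE[OF simple2 assms(4)] unfolding card_power power2_eq_square by blast
  let ?D = "\<lambda>m. {p \<in> ?VV. \<phi> p \<in> C m}"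
  have D: "\<phi> ` ?D m = C m" if "m \<le> n * n" for m
    using C(1)[OF that] bij2 by (auto simp: optimal_def bij_betw_def)
  interpret square_chain R n ?D
  proof
    fix m assume m: "m \<le> n * n"
    have "inj_on \<phi> (?D m)" using bij2 by (auto simp: bij_betw_def intro: inj_on_subset)
    from card_image[OF this] have "card (?D m) = card (C m)" unfolding D[OF m] by (rule sym)
    then show "card (?D m) = m" using C(1)[OF m] by (simp add: optimal_def)
    fix B assume B: "B \<subseteq> ?VV" "card B = m"
    have "\<phi> ` B \<subseteq> verts (cart_power G 2)" using bij2 B by (auto simp: bij_betw_def)
    moreover have "card (\<phi> ` B) = m"
      using bij2 B by (auto simp: bij_betw_def intro!: card_image intro: inj_on_subset)
    ultimately have "arc_count (adj (cart_power G 2)) (\<phi> ` B)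
        \<le> arc_count (adj (cart_power G 2)) (\<phi> ` ?D m)"
      unfolding D[OF m] using C(1)[OF m] by (simp add: optimal_iff[OF simple2])
    then show "arc_count (box R R) B \<le> arc_count (box R R) (?D m)"
      using arc2[OF B(1)] arc2[of "?D m"] by simp
  qed (use symR irrR opt dense C(2) in auto)

  \<comment> \<open>\<open>d - 1\<close> because \<open>initial_optimal_words\<close> speaks of
    words of length \<open>Suc d\<close>.\<close>
  have words_opt: "initial_optimal (list_adj R) (words {..<n} d)"
    using initial_optimal_words[OF _ symR irrR optR initial_optimal_square, of "d - 1"] d by simp
  let ?W = "words {..<n} d"
  have finW: "finite ?W" by (simp add: finite_words)
  have injd: "inj_on (map f) ?W" and imd: "map f ` ?W = verts (cart_power G d)"
    using bij[of d] by (auto simp: bij_betw_def)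
  have arcd: "arc_count (adj (cart_power G d)) (map f ` B) = arc_count (list_adj R) B"
    if "B \<subseteq> ?W" for B
    by (intro arc_count_image inj_on_subset[OF injd that] adjL) (use that in blast)+
  \<comment> \<open>The nested solutions of the power are the lexicographic initial segments of the
    words, renamed letter by letter by \<open>f\<close>.\<close>
  have "optimal (cart_power G d) i (map f ` seg ?W i)" if "i \<le> card (verts (cart_power G d))" for i
  proof -
    have c: "card (seg ?W i) = i"
      using finW that bij_betw_same_card[OF bij[of d]] by (intro card_seg) auto
    have ini: "initial ?W (seg ?W i)" using finW by (rule initial_seg)
    note sub = initial_subset[OF ini]
    have "arc_count (adj (cart_power G d)) B \<le> arc_count (adj (cart_power G d)) (map f ` seg ?W i)"
      if B: "B \<subseteq> verts (cart_power G d)" "card B = i" for B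
    proof -
      obtain B' where B': "B' \<subseteq> ?W" "B = map f ` B'" using B imd by (metis subset_image_iff)
      have "card B' = i" using B' B(2) injd by (metis card_image inj_on_subset)
      then show ?thesis
        using initial_optimalD[OF words_opt ini B'(1)] c arcd[OF B'(1)] arcd[OF sub] B'(2) by simp
    qed
    moreover have "card (map f ` seg ?W i) = i"
      using c card_image[OF inj_on_subset[OF injd sub]] by simp
    ultimately show ?thesis
      using sub imd by (auto simp: optimal_iff[OF simple_graph_cart_power[OF assms(1)]])
  qed
  moreover have "map f ` seg ?W i \<subseteq> map f ` seg ?W (Suc i)" for i
    by (intro image_mono seg_mono) simp
  ultimately show "nested_solutions (cart_power G d)"
    unfolding nested_solutions_def by (intro exI[of _ "\<lambda>i. map f ` seg ?W i"]) auto
qed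

end
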